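(* Let $t_1,t_2\in\mathbb{R}$ and $s_1,s_2>0$, let $\mathbf{W}_\Phi=[W_\Phi(t_1,s_1)\ W_\Phi(t_2,s_2)]^\top$, and assume that $\Gamma=\mathbb{E}[\mathbf{W}_\Phi\mathbf{W}_\Phi^*]$ is invertible. Then $$\mathrm{Cov}\left(|W_Y(t_1,s_1)|,|W_Y(t_2,s_2)|\right)=\int_{\mathbb{C}}|w|\,p\left(w;W_Y(t_1,s_1)W_Y(t_2,s_2)\right)dw-\prod_{\ell=1}^2\int_{\mathbb{C}}|w|\,p\left(w;W_Y(t_\ell,s_\ell)\right)dw,$$ where the probability density function of the product $W_Y(t_1,s_1)W_Y(t_2,s_2)$ is $$p\left(w;W_Y(t_1,s_1)W_Y(t_2,s_2)\right)=\int_0^\infty\int_0^{2\pi}\frac{1}{\pi^2\det(\Gamma)\,r}\exp\left(-\mathbf{u}^*\Gamma^{-1}\mathbf{u}\right)d\theta\,dr,\qquad \mathbf{u}=\begin{bmatrix}re^{i\theta}-W_f(t_1,s_1)\\ wr^{-1}e^{-i\theta}-W_f(t_2,s_2)\end{bmatrix},$$ and $$p\left(w;W_Y(t_\ell,s_\ell)\right)=\frac{1}{\pi\Gamma_{\ell\ell}}\exp\left(-\frac{1}{\Gamma_{\ell\ell}}|w-W_f(t_\ell,s_\ell)|^2\right),\qquad\ell=1,2.$$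
   Context: The function $\psi:\mathbb{R}\to\mathbb{C}$ belongs to $L^1(\mathbb{R})\cap L^2(\mathbb{R})$, with Fourier transform $\widehat\psi(\omega)=\int_{\mathbb{R}}e^{-it\omega}\psi(t)\,dt$. It is an analytic mother wavelet: $\widehat\psi(\omega)=0$ for $\omega\le0$; moreover $|\widehat\psi|$ is unimodal with a unique maximum point in $(0,\infty)$. The function $f:\mathbb{R}\to\mathbb{R}$ is bounded and deterministic. The noise $\Phi=\{\Phi(t)\}_{t\in\mathbb{R}}$ is a real-valued stationary Gaussian process with constant mean and covariance function $C_\Phi(t_1-t_2)=\mathrm{Cov}(\Phi(t_1),\Phi(t_2))$, which has the spectral representation $C_\Phi(t)=\int_{\mathbb{R}}e^{i\lambda t}F(d\lambda)$ with $F$ a nonnegative measure, $F(\mathbb{R})=C_\Phi(0)$. The observed signal is $Y=f+\Phi$. For $g\in\{f,\Phi,Y\}$, the analytic wavelet transform is $W_g(t,s)=\int_{\mathbb{R}}g(\tau)\frac{1}{\sqrt s}\overline{\psi\left(\frac{\tau-t}{s}\right)}d\tau$, $t\in\mathbb{R}$, $s>0$ (so $\mathbb{E}[W_\Phi]=0$ because $\widehat\psi(0)=0$). The notation $p(\cdot;X)$ denotes the probability density function of a complex random variable $X$ with respect to Lebesgue measure $dw$ on $\mathbb{C}\cong\mathbb{R}^2$; $*$ is the conjugate transpose; $\Gamma_{\ell\ell'}$ are the entries of $\Gamma$. *)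

theory Defs
  imports "HOL-Probability.Probability"
begin

definition fourier :: "(real \<Rightarrow> complex) \<Rightarrow> real \<Rightarrow> complex" where
  "fourier \<psi> \<omega> = (\<integral>t. exp (- (\<i> * of_real t * of_real \<omega>)) * \<psi> t \<partial>lborel)"

definition analytic_mother_wavelet :: "(real \<Rightarrow> complex) \<Rightarrow> bool" where
  "analytic_mother_wavelet \<psi> \<longleftrightarrow>
     integrable lborel \<psi> \<and>
     integrable lborel (\<lambda>t. (cmod (\<psi> t))\<^sup>2) \<and>
     (\<forall>\<omega>\<le>0. fourier \<psi> \<omega> = 0) \<and>
     (\<exists>\<omega>\<^sub>0>0.
        mono_on {..\<omega>\<^sub>0} (\<lambda>\<omega>. cmod (fourier \<psi> \<omega>)) \<and>
        antimono_on {\<omega>\<^sub>0..} (\<lambda>\<omega>. cmod (fourier \<psi> \<omega>)) \<and>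
        (\<forall>\<omega>. \<omega> \<noteq> \<omega>\<^sub>0 \<longrightarrow> cmod (fourier \<psi> \<omega>) < cmod (fourier \<psi> \<omega>\<^sub>0)))"

definition wavelet_transform ::
    "(real \<Rightarrow> complex) \<Rightarrow> (real \<Rightarrow> real) \<Rightarrow> real \<Rightarrow> real \<Rightarrow> complex" where
  "wavelet_transform \<psi> g t s =
     (\<integral>\<tau>. of_real (g \<tau>) * of_real (1 / sqrt s) * cnj (\<psi> ((\<tau> - t) / s)) \<partial>lborel)"

(* The second disjunct is the degenerate normal law of variance zero. *)
definition normal_rv :: "'a measure \<Rightarrow> ('a \<Rightarrow> real) \<Rightarrow> bool" where
  "normal_rv M X \<longleftrightarrow>
     (\<exists>\<mu> \<sigma>. \<sigma> > 0 \<and> distributed M lborel X (\<lambda>x. ennreal (normal_density \<mu> \<sigma> x))) \<or>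
     (\<exists>\<mu>. X \<in> borel_measurable M \<and> (AE \<omega> in M. X \<omega> = \<mu>))"

definition gaussian_process :: "'a measure \<Rightarrow> ('t \<Rightarrow> 'a \<Rightarrow> real) \<Rightarrow> bool" where
  "gaussian_process M X \<longleftrightarrow>
     (\<forall>I c. finite I \<longrightarrow> normal_rv M (\<lambda>\<omega>. \<Sum>t\<in>I. c t * X t \<omega>))"

definition covariance :: "'a measure \<Rightarrow> ('a \<Rightarrow> real) \<Rightarrow> ('a \<Rightarrow> real) \<Rightarrow> real" where
  "covariance M X Y =
     (\<integral>\<omega>. (X \<omega> - (\<integral>\<omega>. X \<omega> \<partial>M)) * (Y \<omega> - (\<integral>\<omega>. Y \<omega> \<partial>M)) \<partial>M)"

(* Joint measurability makes every path measurable and the pathwise wavelet transform a random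
   variable.  Since the covariance function is continuous, the process always has a jointly
   measurable version.  For Gaussian processes the moment conditions below amount to strict
   stationarity. *)
definition stationary_gaussian_process ::
    "'a measure \<Rightarrow> (real \<Rightarrow> 'a \<Rightarrow> real) \<Rightarrow> (real \<Rightarrow> real) \<Rightarrow> bool" where
  "stationary_gaussian_process M X C \<longleftrightarrow>
     (\<lambda>(t, \<omega>). X t \<omega>) \<in> borel_measurable (lborel \<Otimes>\<^sub>M M) \<and>
     gaussian_process M X \<and>
     (\<exists>\<mu>. \<forall>t. (\<integral>\<omega>. X t \<omega> \<partial>M) = \<mu>) \<and>
     (\<forall>t\<^sub>1 t\<^sub>2. covariance M (X t\<^sub>1) (X t\<^sub>2) = C (t\<^sub>1 - t\<^sub>2))"

definition spectral_measure :: "real measure \<Rightarrow> (real \<Rightarrow> real) \<Rightarrow> bool" where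
  "spectral_measure F C \<longleftrightarrow>
     sets F = sets borel \<and>
     emeasure F UNIV = ennreal (C 0) \<and>
     (\<forall>t. of_real (C t) = (\<integral>x. exp (\<i> * of_real x * of_real t) \<partial>F))"

definition second_moment_matrix :: "'a measure \<Rightarrow> ('a \<Rightarrow> complex ^ 'n) \<Rightarrow> complex ^ 'n ^ 'n" where
  "second_moment_matrix M W = (\<chi> i j. \<integral>\<omega>. W \<omega> $ i * cnj (W \<omega> $ j) \<partial>M)"

definition hermitian_form :: "complex ^ 'n ^ 'n \<Rightarrow> complex ^ 'n \<Rightarrow> complex" where
  "hermitian_form A u = (\<Sum>i\<in>UNIV. cnj (u $ i) * (A *v u) $ i)"

(* In the two densities, G is a second moment matrix, hence Hermitian and nonnegative: the
   quantities of which the real part is taken are real. *)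
definition complex_normal_density :: "complex \<Rightarrow> complex \<Rightarrow> complex \<Rightarrow> real" where
  "complex_normal_density v m w =
     1 / (pi * Re v) * exp (- (1 / Re v) * (cmod (w - m))\<^sup>2)"

(* For w = 0 the integral over r diverges, so that the value is the conventional 0; this is a
   null set. *)
definition normal_product_density ::
    "complex ^ 2 ^ 2 \<Rightarrow> complex ^ 2 \<Rightarrow> complex \<Rightarrow> real" where
  "normal_product_density G m w =
     (LBINT r:{0<..}. LBINT \<theta>:{0..2 * pi}.
        (let u = vector [of_real r * exp (\<i> * of_real \<theta>) - m $ 1,
                         w * of_real (inverse r) * exp (- (\<i> * of_real \<theta>)) - m $ 2]
         in 1 / (pi\<^sup>2 * Re (det G) * r) * exp (- Re (hermitian_form (matrix_inv G) u))))"

end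

theory Submission
  imports Defs
begin

text \<open>
The wavelet coefficient \<open>W\<^sub>\<Phi>\<close> at \<open>(t, s)\<close> is a path integral \<open>\<integral> h \<tau> * \<Phi> \<tau> d\<tau>\<close> whose complex weight \<open>h\<close>
is integrable and has a Fourier transform that vanishes on a half-line.  This has two effects.

First, real path integrals of a stationary Gaussian process are limits in mean of finite linear
combinations of its values, because the covariance function is continuous; hence their
characteristic functions are Gaussian (\<open>expectation_iexp_process_integral\<close>).  Secondly, by the
spectral representation, \<open>E (I h\<^sub>1 * I h\<^sub>2)\<close> is the integral of \<open>H\<^sub>1 l * H\<^sub>2 (- l)\<close> against the spectral
measure, where \<open>I h\<close> is the path integral of weight \<open>h\<close> and \<open>H\<^sub>i\<close> is the transform of \<open>h\<^sub>i\<close>; one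
of the two factors is always zero, so this second moment without conjugation vanishes
(\<open>expectation_analytic_mult\<close>).  The vector \<open>W\<^sub>\<Phi>\<close> is therefore circular: the variance of
\<open>b \<bullet> W\<^sub>\<Phi>\<close> is half of the Hermitian form of \<open>\<Gamma>\<close> at \<open>b\<close>, and \<open>\<Gamma>\<close> alone determines the
characteristic function (\<open>expectation_iexp_analytic_vec\<close>).

When \<open>\<Gamma>\<close> is invertible, the Cholesky factor of \<open>\<Gamma>\<close> turns \<open>W\<^sub>\<Phi>\<close> into a pair with the
characteristic function of two independent standard complex normal variables.  Uniqueness of the
Fourier transform of finite measures, carried from the line to products of Euclidean spaces
(\<open>fourier_equal_imp_eq_prod\<close>), then identifies the law, and an affine substitution gives the joint
density of \<open>W\<^sub>Y\<close>, which is almost surely \<open>W\<^sub>f + W\<^sub>\<Phi>\<close> (\<open>distributed_pair\<close>).  For the product,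
substitute \<open>v = w / u\<close> in the second variable and pass to polar coordinates in the first
(\<open>distributed_complex_product\<close>); the Jacobians \<open>1 / r\<^sup>2\<close> and \<open>r\<close> combine to the factor \<open>1 / r\<close>.
The covariance formula is then \<open>E (|W\<^sub>1| |W\<^sub>2|) - E |W\<^sub>1| E |W\<^sub>2|\<close>, rewritten with these densities.
\<close>

section \<open>Lebesgue measure on the complex plane\<close>

lemma lborel_complex_eq_distr:
  "(lborel :: complex measure) =
     distr (lborel \<Otimes>\<^sub>M lborel) borel (\<lambda>(x, y). of_real x + \<i> * of_real y)"
proof (rule lborel_eqI)
  fix l u :: complex
  assume le: "\<And>b. b \<in> Basis \<Longrightarrow> l \<bullet> b \<le> u \<bullet> b"
  have le': "Re l \<le> Re u" "Im l \<le> Im u"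
    using le[of 1] le[of \<i>] by (auto simp: inner_complex_def Basis_complex_def)
  have "emeasure (distr (lborel \<Otimes>\<^sub>M lborel) borel (\<lambda>(x, y). complex_of_real x + \<i> * of_real y)) (box l u)
      = emeasure (lborel \<Otimes>\<^sub>M lborel) ({Re l<..<Re u} \<times> {Im l<..<Im u})"
    by (subst emeasure_distr)
       (auto intro!: arg_cong2[where f = emeasure]
         simp: box_def Basis_complex_def inner_complex_def space_pair_measure)
  also have "\<dots> = ennreal (Re u - Re l) * ennreal (Im u - Im l)"
    using le' by (simp add: lborel.emeasure_pair_measure_Times)
  also have "\<dots> = ennreal (\<Prod>b\<in>Basis. (u - l) \<bullet> b)"
    using le' by (simp add: Basis_complex_def inner_complex_def ennreal_mult'')
  finally show "emeasure (distr (lborel \<Otimes>\<^sub>M lborel) borel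
      (\<lambda>(x, y). complex_of_real x + \<i> * of_real y)) (box l u) = ennreal (\<Prod>b\<in>Basis. (u - l) \<bullet> b)" .
qed simp

lemma nn_integral_lborel_complex:
  fixes f :: "complex \<Rightarrow> ennreal"
  assumes [measurable]: "f \<in> borel_measurable borel"
  shows "(\<integral>\<^sup>+z. f z \<partial>lborel) = (\<integral>\<^sup>+x. \<integral>\<^sup>+y. f (of_real x + \<i> * of_real y) \<partial>lborel \<partial>lborel)"
  by (subst lborel_complex_eq_distr, subst nn_integral_distr)
     (auto simp: lborel.nn_integral_fst[symmetric])

text \<open>Multiplication by \<open>c = a + \<i> b\<close> is the real matrix with rows \<open>(a, - b)\<close> and \<open>(b, a)\<close>.  For \<open>a \<noteq> 0\<close> it
factors into two shears and two scalings by \<open>a\<close> and \<open>(a\<^sup>2 + b\<^sup>2) / a\<close>, so that two one-dimensional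
affine substitutions suffice.\<close>

lemma nn_integral_complex_mult:
  fixes f :: "complex \<Rightarrow> ennreal"
  assumes [measurable]: "f \<in> borel_measurable borel" and c: "c \<noteq> 0"
  shows "(\<integral>\<^sup>+z. f z \<partial>lborel) = ennreal ((cmod c)\<^sup>2) * (\<integral>\<^sup>+z. f (c * z) \<partial>lborel)"
proof -
  define a b where "a = Re c" and "b = Im c"
  have ab: "c = of_real a + \<i> * of_real b" "(cmod c)\<^sup>2 = a\<^sup>2 + b\<^sup>2"
    by (simp_all add: a_def b_def complex_eq cmod_power2)
  have *: "(\<integral>\<^sup>+z. f (c * z) \<partial>lborel) =
      (\<integral>\<^sup>+y. \<integral>\<^sup>+x. f (of_real (a * x - b * y) + \<i> * of_real (b * x + a * y)) \<partial>lborel \<partial>lborel)"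
    by (subst nn_integral_lborel_complex, simp, subst lborel_pair.Fubini')
       (auto simp: ab algebra_simps)
  show ?thesis
  proof (cases "a = 0")
    case True
    with c ab have b: "b \<noteq> 0" by auto
    have "(\<integral>\<^sup>+z. f z \<partial>lborel) = (\<integral>\<^sup>+x. \<bar>b\<bar> * (\<integral>\<^sup>+y. f (of_real x + \<i>
        * of_real (b * y)) \<partial>lborel) \<partial>lborel)"
      by (subst nn_integral_lborel_complex, simp, rule nn_integral_cong,
          subst nn_integral_real_affine[where t = 0 and c = b]) (use b in auto)
    also have "\<dots> = \<bar>-b\<bar> * (\<integral>\<^sup>+x. \<bar>b\<bar> * (\<integral>\<^sup>+y. f (of_real (- b * x) + \<i>
        * of_real (b * y)) \<partial>lborel) \<partial>lborel)"
      by (subst nn_integral_real_affine[where t = 0 and c = "-b"]) (use b in auto)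
    also have "\<dots> = ennreal ((cmod c)\<^sup>2) * (\<integral>\<^sup>+z. f (c * z) \<partial>lborel)"
      by (subst *, subst nn_integral_cmult)
         (auto simp: ab True power2_eq_square norm_mult ennreal_mult[symmetric] mult.assoc[symmetric])
    finally show ?thesis .
  next
    case a: False
    \<comment> \<open>the factor by which multiplication by \<open>c\<close> moves the second coordinate of the image when
      the first one is held fixed\<close>
    define d where "d = (a\<^sup>2 + b\<^sup>2) / a"
    have d: "d \<noteq> 0" using a by (auto simp: d_def add_nonneg_eq_0_iff)
    have "(\<integral>\<^sup>+z. f z \<partial>lborel) =
        (\<integral>\<^sup>+x. \<bar>d\<bar> * (\<integral>\<^sup>+y. f (of_real x + \<i> * of_real (b / a * x + d * y)) \<partial>lborel) \<partial>lborel)"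
      by (subst nn_integral_lborel_complex, simp, rule nn_integral_cong,
          subst nn_integral_real_affine[where t = "b / a * x" and c = d for x]) (use d in auto)
    also have "\<dots> = \<bar>d\<bar> * (\<integral>\<^sup>+y. \<integral>\<^sup>+x. f (of_real x + \<i> * of_real (b / a * x + d * y)) \<partial>lborel \<partial>lborel)"
      by (subst lborel_pair.Fubini', simp, subst nn_integral_cmult) auto
    also have "(\<integral>\<^sup>+y. \<integral>\<^sup>+x. f (of_real x + \<i> * of_real (b / a * x + d * y)) \<partial>lborel \<partial>lborel)
        = (\<integral>\<^sup>+y. \<bar>a\<bar> * (\<integral>\<^sup>+x. f (of_real (- b * y + a * x)
             + \<i> * of_real (b / a * (- b * y + a * x) + d * y)) \<partial>lborel) \<partial>lborel)"
      by (rule nn_integral_cong, subst nn_integral_real_affine[where t = "- b * y" and c = a for y])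
         (use a in auto)
    also have "\<dots> = \<bar>a\<bar> * (\<integral>\<^sup>+z. f (c * z) \<partial>lborel)"
    proof -
      have "b / a * (- b * y + a * x) + d * y = b * x + a * y" for x y
        using a by (simp add: d_def field_simps power2_eq_square)
      then show ?thesis by (subst *, subst nn_integral_cmult) (auto simp: algebra_simps)
    qed
    also have "\<bar>d\<bar> * (\<bar>a\<bar> * (\<integral>\<^sup>+z. f (c * z) \<partial>lborel)) = ennreal ((cmod c)\<^sup>2)
        * (\<integral>\<^sup>+z. f (c * z) \<partial>lborel)"
    proof -
      have "\<bar>d\<bar> * \<bar>a\<bar> = (cmod c)\<^sup>2" using a by (simp add: d_def ab(2) abs_mult[symmetric])
      then show ?thesis by (metis ennreal_mult'' abs_ge_zero mult.assoc)
    qed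
    finally show ?thesis .
  qed
qed

lemma nn_integral_complex_affine:
  fixes f :: "complex \<Rightarrow> ennreal"
  assumes [measurable]: "f \<in> borel_measurable borel" and c: "c \<noteq> 0"
  shows "(\<integral>\<^sup>+z. f z \<partial>lborel) = ennreal ((cmod c)\<^sup>2) * (\<integral>\<^sup>+z. f (m + c * z) \<partial>lborel)"
proof -
  have "(\<integral>\<^sup>+z. f z \<partial>lborel) = (\<integral>\<^sup>+z. f z \<partial>distr lborel borel ((+) m))"
    by (simp only: lborel_distr_plus)
  also have "\<dots> = (\<integral>\<^sup>+z. f (m + z) \<partial>lborel)"
    by (subst nn_integral_distr) auto
  also have "\<dots> = ennreal ((cmod c)\<^sup>2) * (\<integral>\<^sup>+z. f (m + c * z) \<partial>lborel)"
    by (rule nn_integral_complex_mult) (use c in auto)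
  finally show ?thesis .
qed

text \<open>The part of the shifted interval beyond \<open>p\<close> is moved back by one period.\<close>

lemma nn_integral_periodic_shift:
  fixes g :: "real \<Rightarrow> ennreal"
  assumes [measurable]: "g \<in> borel_measurable borel"
    and per: "\<And>x. g (x + p) = g x" and a: "0 \<le> a" "a \<le> p"
  shows "(\<integral>\<^sup>+x\<in>{0..p}. g (a + x) \<partial>lborel) = (\<integral>\<^sup>+x\<in>{0..p}. g x \<partial>lborel)"
proof -
  have ae: "(\<integral>\<^sup>+x\<in>{0..p}. h x \<partial>lborel) = (\<integral>\<^sup>+x\<in>{0..<p}. h x \<partial>lborel)" for h :: "real \<Rightarrow> ennreal"
    by (rule nn_integral_cong_AE, rule AE_mp[OF AE_lborel_singleton[of p]])
       (auto simp: indicator_def)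
  have "(\<integral>\<^sup>+x\<in>{0..<p}. g (a + x) \<partial>lborel) = (\<integral>\<^sup>+x\<in>{a..<a+p}. g x \<partial>lborel)"
    by (subst nn_integral_real_affine[where t = a and c = 1 and f = "\<lambda>x. g x * indicator {a..<a+p} x"])
       (auto simp: indicator_def intro!: nn_integral_cong)
  also have "\<dots> = (\<integral>\<^sup>+x. g x * indicator {a..<p} x + g x * indicator {p..<a+p} x \<partial>lborel)"
    using a by (intro nn_integral_cong) (auto simp: indicator_def)
  also have "\<dots> = (\<integral>\<^sup>+x\<in>{a..<p}. g x \<partial>lborel) + (\<integral>\<^sup>+x\<in>{p..<a+p}. g x \<partial>lborel)"
    by (rule nn_integral_add) auto
  also have "(\<integral>\<^sup>+x\<in>{p..<a+p}. g x \<partial>lborel) = (\<integral>\<^sup>+x\<in>{0..<a}. g x \<partial>lborel)"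
    by (subst nn_integral_real_affine[where t = p and c = 1])
       (auto simp: indicator_def per[unfolded add.commute[of _ p]] intro!: nn_integral_cong)
  also have "(\<integral>\<^sup>+x\<in>{a..<p}. g x \<partial>lborel) + (\<integral>\<^sup>+x\<in>{0..<a}. g x \<partial>lborel) =
      (\<integral>\<^sup>+x. g x * indicator {a..<p} x + g x * indicator {0..<a} x \<partial>lborel)"
    by (rule nn_integral_add[symmetric]) auto
  also have "\<dots> = (\<integral>\<^sup>+x\<in>{0..<p}. g x \<partial>lborel)"
    using a by (intro nn_integral_cong) (auto simp: indicator_def)
  finally show ?thesis by (simp only: ae)
qed

text \<open>Both sides give the half-line \<open>{..r}\<close> the area of the disc of radius \<open>r\<close>.\<close>

lemma distr_cmod_lborel:
  "distr lborel borel cmod = density lborel (\<lambda>r. ennreal (2 * pi * r) * indicator {0<..} r)"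
proof -
  let ?N = "density lborel (\<lambda>r. ennreal (2 * pi * r) * indicator {0<..} r)"
  have M: "emeasure (distr lborel borel cmod) {..r} = (if r < 0 then 0 else ennreal (pi * r\<^sup>2))" for r
  proof -
    have "emeasure (distr lborel borel cmod) {..r} = emeasure lborel (cball (0 :: complex) r)"
      by (subst emeasure_distr) (auto intro!: arg_cong2[where f = emeasure] simp: cball_def)
    also have "\<dots> = (if r < 0 then 0 else ennreal (pi * r\<^sup>2))"
      by (auto simp: emeasure_cball unit_ball_vol_2)
    finally show ?thesis .
  qed
  have N: "emeasure ?N {..r} = (if r < 0 then 0 else ennreal (pi * r\<^sup>2))" for r
  proof -
    have "emeasure ?N {..r} = (\<integral>\<^sup>+x. ennreal (2 * pi * x) * indicator {0..r} x \<partial>lborel)"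
      by (subst emeasure_density) (auto intro!: nn_integral_cong simp: indicator_def)
    also have "\<dots> = (if r < 0 then 0 else ennreal (pi * r\<^sup>2))"
    proof (cases "r < 0")
      case False
      then have "(\<integral>\<^sup>+x. ennreal (2 * pi * x) * indicator {0..r} x \<partial>lborel)
          = ennreal (pi * r\<^sup>2 - pi * 0\<^sup>2)"
        by (intro nn_integral_FTC_Icc) (auto intro!: derivative_eq_intros)
      with False show ?thesis by simp
    qed (auto simp: indicator_def)
    finally show ?thesis .
  qed
  show ?thesis
  proof (rule measure_eqI_generator_eq[where \<Omega> = UNIV and E = "range atMost" and A = "\<lambda>n. {..real n}"])
    show "Int_stable (range atMost :: real set set)"
      by (auto simp: Int_stable_def)
    show "sets (distr lborel borel cmod) = sigma_sets UNIV (range atMost)"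
         "sets ?N = sigma_sets UNIV (range atMost)"
      by (simp_all add: borel_eq_atMost)
    show "(\<Union>n. {..real n}) = UNIV"
      by (auto intro: real_arch_simple)
  qed (auto simp: M N)
qed

text \<open>By rotation invariance, the integral of \<open>f\<close> is the average over \<open>\<theta>\<close> of the integrals of
\<open>z \<mapsto> f (exp (\<i> \<theta>) * z)\<close>.  Averaging inside instead leaves a function of \<open>cmod z\<close>, whose integral is
governed by the law of the modulus.\<close>

lemma nn_integral_complex_polar:
  fixes f :: "complex \<Rightarrow> ennreal"
  assumes [measurable]: "f \<in> borel_measurable borel"
  shows "(\<integral>\<^sup>+z. f z \<partial>lborel) =
    (\<integral>\<^sup>+r\<in>{0<..}. (\<integral>\<^sup>+\<theta>\<in>{0..2 * pi}. ennreal r * f (of_real r * exp (\<i> * of_real \<theta>)) \<partial>lborel) \<partial>lborel)"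
proof -
  define G where "G r = (\<integral>\<^sup>+\<theta>\<in>{0..2 * pi}. f (of_real r * exp (\<i> * of_real \<theta>)) \<partial>lborel)" for r
  have [measurable]: "G \<in> borel_measurable borel"
    unfolding G_def by measurable
  have G: "(\<integral>\<^sup>+\<theta>\<in>{0..2 * pi}. f (exp (\<i> * of_real \<theta>) * z) \<partial>lborel) = G (cmod z)" for z
  proof -
    have z: "z = of_real (cmod z) * exp (\<i> * of_real (Arg2pi z))"
      by (rule Arg2pi_eq)
    have "(\<integral>\<^sup>+\<theta>\<in>{0..2 * pi}. f (exp (\<i> * of_real \<theta>) * z) \<partial>lborel) =
        (\<integral>\<^sup>+\<theta>\<in>{0..2 * pi}. f (of_real (cmod z) * exp (\<i> * of_real (Arg2pi z + \<theta>))) \<partial>lborel)"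
      by (subst z) (simp add: exp_add algebra_simps)
    also have "\<dots> = G (cmod z)"
      unfolding G_def
    proof (rule nn_integral_periodic_shift)
      fix x :: real
      have "exp (\<i> * of_real (x + 2 * pi)) = exp (\<i> * of_real x)"
        using exp_plus_2pin[of "\<i> * of_real x" 1] by (simp add: algebra_simps)
      then show "f (of_real (cmod z) * exp (\<i> * of_real (x + 2 * pi))) =
          f (of_real (cmod z) * exp (\<i> * of_real x))" by simp
    qed (auto simp: Arg2pi_ge_0 Arg2pi_lt_2pi less_imp_le)
    finally show ?thesis .
  qed
  have "ennreal (2 * pi) * (\<integral>\<^sup>+z. f z \<partial>lborel) =
      (\<integral>\<^sup>+\<theta>\<in>{0..2 * pi}. (\<integral>\<^sup>+z. f z \<partial>lborel) \<partial>(lborel :: real measure))"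
    by (subst nn_integral_cmult_indicator) (auto simp: mult.commute)
  also have "\<dots> = (\<integral>\<^sup>+\<theta>\<in>{0..2 * pi}. (\<integral>\<^sup>+z. f (exp (\<i> * of_real \<theta>) * z) \<partial>lborel) \<partial>lborel)"
    by (intro nn_integral_cong arg_cong2[where f = "(*)"] refl
          trans[OF nn_integral_complex_mult[where c = "exp (\<i> * of_real \<theta>)" for \<theta>]]) auto
  also have "\<dots> = (\<integral>\<^sup>+\<theta>. \<integral>\<^sup>+z. f (exp (\<i> * of_real \<theta>) * z) * indicator {0..2 * pi} \<theta> \<partial>lborel \<partial>lborel)"
    by (intro nn_integral_cong) (simp add: nn_integral_multc)
  also have "\<dots> = (\<integral>\<^sup>+z. \<integral>\<^sup>+\<theta>. f (exp (\<i> * of_real \<theta>) * z) * indicator {0..2 * pi} \<theta> \<partial>lborel \<partial>lborel)"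
    by (rule pair_sigma_finite.Fubini') (auto intro:
        pair_sigma_finite.intro lborel.sigma_finite_measure_axioms)
  also have "\<dots> = (\<integral>\<^sup>+z. G (cmod z) \<partial>lborel)"
    by (simp only: G)
  also have "\<dots> = (\<integral>\<^sup>+r. G r \<partial>distr (lborel :: complex measure) borel cmod)"
    by (subst nn_integral_distr) auto
  also have "\<dots> = (\<integral>\<^sup>+r. ennreal (2 * pi) * (ennreal r * G r * indicator {0<..} r) \<partial>lborel)"
    by (subst distr_cmod_lborel, subst nn_integral_density)
       (auto intro!: nn_integral_cong simp: indicator_def ennreal_mult mult_ac)
  also have "\<dots> = ennreal (2 * pi) * (\<integral>\<^sup>+r\<in>{0<..}. ennreal r * G r \<partial>lborel)"
    by (rule nn_integral_cmult) auto
  finally have "(\<integral>\<^sup>+z. f z \<partial>lborel) = (\<integral>\<^sup>+r\<in>{0<..}. ennreal r * G r \<partial>lborel)"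
    by (subst (asm) ennreal_mult_cancel_left) auto
  also have "\<dots> = (\<integral>\<^sup>+r\<in>{0<..}. (\<integral>\<^sup>+\<theta>\<in>{0..2 * pi}. ennreal r
      * f (of_real r * exp (\<i> * of_real \<theta>)) \<partial>lborel) \<partial>lborel)"
    unfolding G_def by (subst nn_integral_cmult[symmetric]) (auto simp: mult_ac)
  finally show ?thesis .
qed

section \<open>Fourier uniqueness and the standard complex normal law\<close>

lemma (in pair_sigma_finite)
  fixes f :: "'a \<Rightarrow> 'c::{real_normed_field, banach, second_countable_topology}" and g :: "'b \<Rightarrow> 'c"
  assumes f: "integrable M1 f" and g: "integrable M2 g"
  shows integrable_pair_mult: "integrable (M1 \<Otimes>\<^sub>M M2) (\<lambda>z. f (fst z) * g (snd z))"
    and integral_pair_mult: "(\<integral>z. f (fst z) * g (snd z) \<partial>(M1 \<Otimes>\<^sub>M M2)) = (\<integral>x. f x \<partial>M1) * (\<integral>y. g y \<partial>M2)"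
proof -
  have [measurable]: "f \<in> borel_measurable M1" "g \<in> borel_measurable M2"
    using f g by auto
  show int: "integrable (M1 \<Otimes>\<^sub>M M2) (\<lambda>z. f (fst z) * g (snd z))"
    by (rule Fubini_integrable) (use f g in \<open>auto simp: norm_mult\<close>)
  from integral_fst'[OF int] show "(\<integral>z. f (fst z) * g (snd z) \<partial>(M1 \<Otimes>\<^sub>M M2)) = (\<integral>x. f x \<partial>M1)
      * (\<integral>y. g y \<partial>M2)"
    by simp
qed

text \<open>Finite measures instead of probability measures: the induction over products below applies
uniqueness to weighted measures and to restrictions, whose mass is arbitrary.\<close>

definition fourier_equal :: "'v::euclidean_space measure \<Rightarrow> 'v measure \<Rightarrow> bool" where
  "fourier_equal P Q \<longleftrightarrow>
     finite_measure P \<and> finite_measure Q \<and> sets P = sets borel \<and> sets Q = sets borel \<and>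
     (\<forall>v. (\<integral>x. iexp (v \<bullet> x) \<partial>P) = (\<integral>x. iexp (v \<bullet> x) \<partial>Q))"

text \<open>The two masses are the values of the transforms at zero, so they agree; after normalisation this is
Levy's uniqueness theorem.\<close>

lemma fourier_equal_imp_eq_real:
  fixes P Q :: "real measure"
  assumes "fourier_equal P Q"
  shows "P = Q"
proof -
  interpret P: finite_measure P using assms by (simp add: fourier_equal_def)
  interpret Q: finite_measure Q using assms by (simp add: fourier_equal_def)
  have sets [measurable_cong]: "sets P = sets borel" "sets Q = sets borel"
    and eq: "\<And>v. (\<integral>x. iexp (v * x) \<partial>P) = (\<integral>x. iexp (v * x) \<partial>Q)"
    using assms by (auto simp: fourier_equal_def)
  have sp: "space P = UNIV" "space Q = UNIV"
    using sets[THEN sets_eq_imp_space_eq] by auto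
  define c where "c = measure P UNIV"
  have c: "measure Q UNIV = c"
    using eq[of 0] by (simp add: c_def sp of_real_eq_iff[symmetric, where 'a = complex] del:
        of_real_eq_iff)
  have em: "emeasure P UNIV = ennreal c" "emeasure Q UNIV = ennreal c"
    using P.emeasure_eq_measure[of UNIV] Q.emeasure_eq_measure[of UNIV] c by (simp_all add: c_def)
  show ?thesis
  proof (cases "c = 0")
    case True
    show ?thesis
    proof (rule measure_eqI)
      fix A assume "A \<in> sets P"
      have "emeasure P A \<le> emeasure P UNIV" "emeasure Q A \<le> emeasure Q UNIV"
        using sp sets by (metis emeasure_space)+
      then show "emeasure P A = emeasure Q A" using em True by simp
    qed (simp add: sets)
  next
    case False
    then have c0: "c > 0" by (simp add: c_def less_le)
    define s where "s R = density R (\<lambda>_. ennreal (1 / c))" for R :: "real measure"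
    have s: "real_distribution (s R)" if "sets R = sets borel" "emeasure R UNIV = ennreal c" for R
    proof -
      have "space R = UNIV" using that(1)[THEN sets_eq_imp_space_eq] by simp
      then have "prob_space (s R)"
        using c0 that by (intro prob_spaceI) (auto simp:
            s_def emeasure_density ennreal_mult''[symmetric])
      then show ?thesis
        using that by (auto simp: real_distribution_def real_distribution_axioms_def s_def)
    qed
    have ch: "char (s R) v = (1 / c) *\<^sub>R (\<integral>x. iexp (v * x) \<partial>R)" if [measurable_cong]: "sets R
        = sets borel" for R v
      unfolding char_def s_def using c0 by (subst integral_density) auto
    have "s P = s Q"
      by (rule Levy_uniqueness) (use s sets em ch eq in \<open>auto\<close>)
    then have s_eq: "emeasure (s P) A = emeasure (s Q) A" for A by simp
    show ?thesis
    proof (rule measure_eqI)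
      fix A assume "A \<in> sets P"
      then have A: "A \<in> sets P" "A \<in> sets Q" by (auto simp: sets)
      have "ennreal (1 / c) * emeasure P A = ennreal (1 / c) * emeasure Q A"
        using s_eq[of A] A by (simp add: s_def emeasure_density nn_integral_cmult_indicator)
      then show "emeasure P A = emeasure Q A"
        using c0 by (subst (asm) ennreal_mult_cancel_left) auto
    qed (simp add: sets)
  qed
qed

text \<open>Uniqueness in the first coordinate, applied to the measures weighted by trigonometric functions of
the second coordinate, shows that \<open>\<integral> 1\<^sub>A x * iexp (b \<bullet> y)\<close> agrees for every Borel set \<open>A\<close> and every
\<open>b\<close>.  Uniqueness in the second coordinate, applied to the restrictions to \<open>A\<close>, then gives equality
on rectangles.\<close>

lemma fourier_equal_imp_eq_prod:
  fixes P Q :: "('v::euclidean_space \<times> 'w::euclidean_space) measure"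
  assumes v: "\<And>P Q :: 'v measure. fourier_equal P Q \<Longrightarrow> P = Q"
    and w: "\<And>P Q :: 'w measure. fourier_equal P Q \<Longrightarrow> P = Q"
    and PQ: "fourier_equal P Q"
  shows "P = Q"
proof -
  have fin: "finite_measure R" and sets: "sets R = sets (borel \<Otimes>\<^sub>M borel)" 
    and sp: "space R = UNIV" if "R \<in> {P, Q}" for R
    using PQ that unfolding borel_prod by (auto simp: fourier_equal_def dest: sets_eq_imp_space_eq)
  have eq: "(\<integral>z. iexp (a \<bullet> fst z + b \<bullet> snd z) \<partial>P) = (\<integral>z. iexp (a \<bullet> fst z + b \<bullet> snd z) \<partial>Q)" for a b
  proof -
    have "\<forall>v. (\<integral>x. iexp (v \<bullet> x) \<partial>P) = (\<integral>x. iexp (v \<bullet> x) \<partial>Q)"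
      using PQ by (simp add: fourier_equal_def)
    from spec[OF this, of "(a, b)"] show ?thesis by (simp add: inner_prod_def)
  qed
  have int: "integrable R f" if R: "R \<in> {P, Q}" and [measurable]: "f \<in> borel_measurable R"
      and B: "\<And>z. norm (f z) \<le> B" for R B and f :: "_ \<Rightarrow> 'b::{banach,second_countable_topology}"
    by (rule finite_measure.integrable_const_bound[OF fin[OF R], of _ B]) (use B in auto)
  define D where "D R g = distr (density R (\<lambda>z. ennreal (g z))) borel fst" for R
      and g :: "'v \<times> 'w \<Rightarrow> real"
  \<comment> \<open>Uniqueness in the first coordinate speaks of nonnegative measures only, so the character of
    the second coordinate enters through the weight \<open>1 + Re (c * iexp (b \<bullet> y))\<close>; the choices
    \<open>c = 1\<close> and \<open>c = - \<i>\<close> give its real and its imaginary part.\<close>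
  have weight: "(\<integral>z. g z * indicator A (fst z) \<partial>P) = (\<integral>z. g z * indicator A (fst z) \<partial>Q)"
    if A: "A \<in> sets borel" and g: "\<And>z. g z = 1 + Re (c * iexp (b \<bullet> snd z))" and c: "cmod c = 1"
        for A g b c
  proof -
    have gm: "g \<in> borel_measurable R" if "R \<in> {P, Q}" for R
    proof -
      have [measurable_cong]: "sets R = sets (borel \<Otimes>\<^sub>M borel)" by (rule sets[OF that])
      show ?thesis unfolding g[abs_def] by measurable
    qed
    have bd: "\<bar>Re (c * iexp (b \<bullet> snd z))\<bar> \<le> 1" for z :: "'v \<times> 'w"
      using abs_Re_le_cmod[of "c * iexp (b \<bullet> snd z)"] c by (simp add: norm_mult)
    have g0: "0 \<le> g z" and g2: "\<bar>g z\<bar> \<le> 2" for z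
      using bd[of z] unfolding g by auto
    have ch: "(\<integral>x. iexp (a \<bullet> x) \<partial>D R g) = (\<integral>z. iexp (a \<bullet> fst z + 0 \<bullet> snd z) \<partial>R)
       + c / 2 * (\<integral>z. iexp (a \<bullet> fst z + b \<bullet> snd z) \<partial>R)
       + cnj c / 2 * (\<integral>z. iexp (a \<bullet> fst z + (- b) \<bullet> snd z) \<partial>R)" if R: "R \<in> {P, Q}" for R a
    proof -
      note [measurable] = gm[OF R]
      have [measurable_cong]: "sets R = sets (borel \<Otimes>\<^sub>M borel)" by (rule sets[OF R])
      have i: "integrable R (\<lambda>z. iexp (a \<bullet> fst z + b' \<bullet> snd z))" for b'
        by (rule int[OF R, of _ 1]) auto
      have "(\<integral>x. iexp (a \<bullet> x) \<partial>D R g) = (\<integral>z. g z *\<^sub>R iexp (a \<bullet> fst z) \<partial>R)"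
        unfolding D_def by (subst integral_distr, simp, simp, subst integral_density) (auto simp: g0)
      also have "\<dots> = (\<integral>z. iexp (a \<bullet> fst z + 0 \<bullet> snd z) + c / 2 * iexp (a \<bullet> fst z + b \<bullet> snd z)
          + cnj c / 2 * iexp (a \<bullet> fst z + (- b) \<bullet> snd z) \<partial>R)"
      proof (rule Bochner_Integration.integral_cong[OF refl])
        fix z
        have "complex_of_real (g z) = 1 + (c * iexp (b \<bullet> snd z) + cnj c * iexp (- (b \<bullet> snd z))) / 2"
          using complex_add_cnj[of "c * iexp (b \<bullet> snd z)"]
          by (simp add: g exp_cnj)
        note gz = this
        show "g z *\<^sub>R iexp (a \<bullet> fst z) = iexp (a \<bullet> fst z + 0 \<bullet> snd z)
            + c / 2 * iexp (a \<bullet> fst z + b \<bullet> snd z) + cnj c / 2 * iexp (a \<bullet> fst z + (- b) \<bullet> snd z)"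
          unfolding scaleR_conv_of_real gz
          by (simp add: exp_add exp_diff exp_minus distrib_left) (simp add: exp_diff field_simps)
      qed
      also have "\<dots> = (\<integral>z. iexp (a \<bullet> fst z + 0 \<bullet> snd z) \<partial>R)
         + c / 2 * (\<integral>z. iexp (a \<bullet> fst z + b \<bullet> snd z) \<partial>R)
         + cnj c / 2 * (\<integral>z. iexp (a \<bullet> fst z + (- b) \<bullet> snd z) \<partial>R)"
        using i[of 0] i[of b] i[of "-b"] by (simp del: inner_zero_left inner_minus_left)
      finally show ?thesis .
    qed
    have finD: "finite_measure (D R g)" if R: "R \<in> {P, Q}" for R
    proof -
      note [measurable] = gm[OF R]
      have [measurable_cong]: "sets R = sets (borel \<Otimes>\<^sub>M borel)" by (rule sets[OF R])
      have "integrable R g" by (rule int[OF R gm[OF R], of 2]) (use g2 in auto)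
      then have "(\<integral>\<^sup>+z. ennreal (g z) \<partial>R) \<noteq> \<infinity>"
        using g0 by (simp add: nn_integral_eq_integral)
      then have "finite_measure (density R (\<lambda>z. ennreal (g z)))"
        using sets.top[of R] by (intro finite_measureI) (simp add: emeasure_density sp[OF R])
      then show ?thesis unfolding D_def by (rule finite_measure.finite_measure_distr) simp
    qed
    have "(\<integral>x. iexp (a \<bullet> x) \<partial>D P g) = (\<integral>x. iexp (a \<bullet> x) \<partial>D Q g)" for a
      using ch[of P a] ch[of Q a] eq[of a 0] eq[of a b] eq[of a "- b"]
      by (simp del: inner_zero_left inner_minus_left)
    then have DD: "D P g = D Q g"
      using finD[of P] finD[of Q] by (intro v) (simp add: fourier_equal_def, simp add: D_def)
    have m: "measure (D R g) A = (\<integral>z. g z * indicator A (fst z) \<partial>R)" if R: "R \<in> {P, Q}" for R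
    proof -
      note [measurable] = gm[OF R] A
      have [measurable_cong]: "sets R = sets (borel \<Otimes>\<^sub>M borel)" by (rule sets[OF R])
      have "measure (D R g) A = (\<integral>x. indicator A x \<partial>D R g)" using A by (simp add: D_def)
      also have "\<dots> = (\<integral>z. g z * indicator A (fst z) \<partial>R)"
        unfolding D_def by (subst integral_distr, simp, simp, subst integral_density) (auto simp: g0)
      finally show ?thesis .
    qed
    from m[of P] m[of Q] DD show ?thesis by simp
  qed
  have Re_eq: "(\<integral>z. Re (c * iexp (b \<bullet> snd z)) * indicator A (fst z) \<partial>P) =
      (\<integral>z. Re (c * iexp (b \<bullet> snd z)) * indicator A (fst z) \<partial>Q)"
    if A[measurable]: "A \<in> sets borel" and c: "cmod c = 1" for A b c
  proof -
    have *: "(\<integral>z. (1 + Re (c * iexp (b \<bullet> snd z))) * indicator A (fst z) \<partial>R) - 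
        (1/2) * (\<integral>z. (1 + Re (1 * iexp (0 \<bullet> snd z))) * indicator A (fst z) \<partial>R)
        = (\<integral>z. Re (c * iexp (b \<bullet> snd z)) * indicator A (fst z) \<partial>R)" if R: "R \<in> {P, Q}" for R
    proof -
      have [measurable_cong]: "sets R = sets (borel \<Otimes>\<^sub>M borel)" by (rule sets[OF R])
      have bd: "\<bar>Re (c * iexp (b \<bullet> snd z))\<bar> \<le> 1" for z :: "'v \<times> 'w"
        using abs_Re_le_cmod[of "c * iexp (b \<bullet> snd z)"] c by (simp add: norm_mult)
      have "integrable R (\<lambda>z. Re (c * iexp (b \<bullet> snd z)) * indicator A (fst z))"
        by (rule int[OF R, of _ 1]) (use bd in \<open>auto simp: indicator_def\<close>)
      moreover have "integrable R (\<lambda>z. indicator A (fst z) :: real)"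
        by (rule int[OF R, of _ 1]) (auto simp: indicator_def)
      ultimately show ?thesis by (simp add: distrib_right)
    qed
    show ?thesis
      using *[of P] *[of Q] weight[OF A refl c, of b] weight[OF A refl norm_one, of 0] by simp
  qed
  have snd_eq: "distr (density P (\<lambda>z. indicator A (fst z))) borel snd =
      distr (density Q (\<lambda>z. indicator A (fst z))) borel snd" if A[measurable]: "A \<in> sets borel" for A
  proof (rule w, unfold fourier_equal_def, intro conjI allI)
    have f: "finite_measure (distr (density R (\<lambda>z. indicator A (fst z))) borel snd)"
        if R: "R \<in> {P, Q}" for R
    proof -
      have [measurable_cong]: "sets R = sets (borel \<Otimes>\<^sub>M borel)" by (rule sets[OF R])
      have "(\<integral>\<^sup>+z. indicator A (fst z) \<partial>R) \<le> (\<integral>\<^sup>+z. 1 \<partial>R)"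
        by (rule nn_integral_mono) (auto simp: indicator_def)
      also have "\<dots> < \<infinity>"
        using finite_measure.emeasure_finite[OF fin[OF R], of UNIV] sp[OF R] by (simp add: less_top)
      finally have "finite_measure (density R (\<lambda>z. indicator A (fst z)))"
        using sets.top[of R] by (intro finite_measureI) (simp add: emeasure_density sp[OF R])
      then show ?thesis by (rule finite_measure.finite_measure_distr) simp
    qed
    show "finite_measure (distr (density P (\<lambda>z. indicator A (fst z))) borel snd)"
         "finite_measure (distr (density Q (\<lambda>z. indicator A (fst z))) borel snd)"
      using f by auto
    fix b
    have "(\<integral>y. iexp (b \<bullet> y) \<partial>distr (density R (\<lambda>z. indicator A (fst z))) borel snd) =
      Complex (\<integral>z. Re (1 * iexp (b \<bullet> snd z)) * indicator A (fst z) \<partial>R)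
        (\<integral>z. Re (- \<i> * iexp (b \<bullet> snd z)) * indicator A (fst z) \<partial>R)" if R: "R \<in> {P, Q}" for R
    proof -
      have [measurable_cong]: "sets R = sets (borel \<Otimes>\<^sub>M borel)" by (rule sets[OF R])
      have *: "density R (\<lambda>z. indicator A (fst z)) = density R (\<lambda>z. ennreal (indicator A (fst z)))"
        by (simp add: ennreal_indicator)
      have i: "integrable R (\<lambda>z. indicator A (fst z) *\<^sub>R iexp (b \<bullet> snd z))"
        by (rule int[OF R, of _ 1]) (auto simp: indicator_def)
      have "(\<integral>y. iexp (b \<bullet> y) \<partial>distr (density R (\<lambda>z. indicator A (fst z))) borel snd) =
        (\<integral>z. indicator A (fst z) *\<^sub>R iexp (b \<bullet> snd z) \<partial>R)"
        unfolding * by (subst integral_distr, simp, simp, subst integral_density) auto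
      then show ?thesis
        using integral_Re[OF i] integral_Im[OF i] by (simp add: complex_eq_iff mult.commute)
    qed
    then show "(\<integral>y. iexp (b \<bullet> y) \<partial>distr (density P (\<lambda>z. indicator A (fst z))) borel snd) =
      (\<integral>y. iexp (b \<bullet> y) \<partial>distr (density Q (\<lambda>z. indicator A (fst z))) borel snd)"
      using Re_eq[OF A, of 1 b] Re_eq[OF A, of "- \<i>" b] by simp
  qed simp_all
  have rect: "emeasure P (A \<times> B) = emeasure Q (A \<times> B)" if A[measurable]: "A \<in> sets borel"
      and B[measurable]: "B \<in> sets borel" for A B
  proof -
    have "emeasure (distr (density R (\<lambda>z. indicator A (fst z))) borel snd) B = emeasure R (A \<times> B)"
      if R: "R \<in> {P, Q}" for R
    proof -
      have [measurable_cong]: "sets R = sets (borel \<Otimes>\<^sub>M borel)" by (rule sets[OF R])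
      have "snd \<in> measurable R borel" by measurable
      from measurable_sets[OF this B] have B': "snd -` B \<in> sets R" by (simp add: sp[OF R])
      have "emeasure (distr (density R (\<lambda>z. indicator A (fst z))) borel snd) B
          = emeasure (density R (\<lambda>z. indicator A (fst z))) (snd -` B)"
        by (subst emeasure_distr) (auto simp: sp[OF R])
      also have "\<dots> = (\<integral>\<^sup>+z. indicator A (fst z) * indicator (snd -` B) z \<partial>R)"
        using B' by (subst emeasure_density) auto
      also have "\<dots> = (\<integral>\<^sup>+z. indicator (A \<times> B) z \<partial>R)"
        by (rule nn_integral_cong) (auto split: split_indicator)
      also have "\<dots> = emeasure R (A \<times> B)"
        by (subst nn_integral_indicator) (auto simp: sets[OF R])
      finally show ?thesis .
    qed
    from this[of P] this[of Q] snd_eq[OF A] show ?thesis by simp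
  qed
  show ?thesis
  proof (rule measure_eqI_generator_eq[OF Int_stable_pair_measure_generator[of borel borel], where
      \<Omega> = UNIV
        and A = "\<lambda>_. UNIV"])
    show "{a \<times> b |a b. a \<in> sets borel \<and> b \<in> sets borel} \<subseteq> Pow (UNIV :: ('v \<times> 'w) set)" by simp
    show "sets P = sigma_sets UNIV {a \<times> b |a b. a \<in> sets borel \<and> b \<in> sets borel}"
         "sets Q = sigma_sets UNIV {a \<times> b |a b. a \<in> sets borel \<and> b \<in> sets borel}"
      by (simp_all add: sets sets_pair_measure)
    show "range (\<lambda>_. UNIV) \<subseteq> {a \<times> b |a b. a \<in> sets borel \<and> b \<in> (sets borel :: 'w set set)}"
      by (auto intro!: exI[of _ UNIV])
    show "emeasure P UNIV \<noteq> \<infinity>"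
      using finite_measure.emeasure_finite[OF fin, of P UNIV] by simp
  qed (auto simp: rect)
qed

text \<open>The plane is the product of two lines, and the real inner product on it is the Euclidean one.\<close>

lemma fourier_equal_imp_eq_complex:
  fixes P Q :: "complex measure"
  assumes PQ: "fourier_equal P Q"
  shows "P = Q"
proof -
  have sets: "sets R = sets borel" and fin: "finite_measure R" if "R \<in> {P, Q}" for R
    using PQ that by (auto simp: fourier_equal_def)
  define D where "D R = distr R borel (\<lambda>z. (Re z, Im z))" for R
  have R: "R = distr (D R) borel (\<lambda>(x, y). of_real x + \<i> * of_real y)" if "R \<in> {P, Q}" for R
  proof -
    have [measurable_cong]: "sets R = sets borel" by (rule sets[OF that])
    have [measurable]: "(\<lambda>(x, y). complex_of_real x + \<i> * of_real y) \<in> borel_measurable borel"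
      by (simp add: borel_prod[symmetric])
    have "distr (D R) borel (\<lambda>(x, y). of_real x + \<i> * of_real y) = distr R borel (\<lambda>z. z)"
      unfolding D_def by (subst distr_distr) (auto simp: comp_def complex_eq[symmetric])
    also have "\<dots> = R" by (rule distr_id2) (simp add: sets[OF that])
    finally show ?thesis ..
  qed
  have DPQ: "D P = D Q"
  proof (rule fourier_equal_imp_eq_prod)
    have "(\<integral>z. iexp (v \<bullet> z) \<partial>D R) = (\<integral>z. iexp (Complex (fst v) (snd v) \<bullet> z) \<partial>R)" if "R \<in> {P, Q}" for R v
    proof -
      have [measurable_cong]: "sets R = sets borel" by (rule sets[OF that])
      have v: "(\<lambda>z. iexp (v \<bullet> z)) \<in> borel_measurable borel"
        by (intro borel_measurable_continuous_onI continuous_intros)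
      show ?thesis unfolding D_def
        by (subst integral_distr, simp, rule v) (simp add: inner_prod_def inner_complex_def)
    qed
    moreover have "finite_measure (D R)" if "R \<in> {P, Q}" for R
    proof -
      have [measurable_cong]: "sets R = sets borel" by (rule sets[OF that])
      show ?thesis unfolding D_def by (rule finite_measure.finite_measure_distr[OF fin[OF that]]) simp
    qed
    ultimately show "fourier_equal (D P) (D Q)"
      using PQ by (simp add: fourier_equal_def) (simp add: D_def)
  qed (rule fourier_equal_imp_eq_real, assumption)+
  have "P = distr (D P) borel (\<lambda>(x, y). of_real x + \<i> * of_real y)" by (rule R) simp
  also have "\<dots> = distr (D Q) borel (\<lambda>(x, y). of_real x + \<i> * of_real y)" by (simp only: DPQ)
  also have "\<dots> = Q" by (rule R[symmetric]) simp
  finally show ?thesis .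
qed

lemma (in prob_space) expectation_iexp_normal:
  assumes \<sigma>: "0 < \<sigma>" and D: "distributed M lborel X (\<lambda>x. ennreal (normal_density \<mu> \<sigma> x))"
  shows "(\<integral>\<omega>. iexp (u * X \<omega>) \<partial>M) = iexp (u * \<mu>) * of_real (exp (- (u\<^sup>2 * \<sigma>\<^sup>2) / 2))"
proof -
  define Y where "Y \<omega> = (X \<omega> - \<mu>) / \<sigma>" for \<omega>
  have Y: "distributed M lborel Y (\<lambda>x. ennreal (std_normal_density x))"
    using normal_standard_normal_convert[OF \<sigma>] D by (simp add: Y_def[abs_def])
  have [measurable]: "Y \<in> borel_measurable M" using distributed_measurable[OF Y] by simp
  have Ydistr: "distr M lborel Y = std_normal_distribution"
    using distributed_distr_eq_density[OF Y] by simp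
  have X: "u * X \<omega> = u * \<mu> + (u * \<sigma>) * Y \<omega>" for \<omega>
    using \<sigma> by (simp add: Y_def field_simps)
  have "(\<integral>\<omega>. iexp (u * X \<omega>) \<partial>M) = (\<integral>\<omega>. iexp (u * \<mu>) * iexp ((u * \<sigma>) * Y \<omega>) \<partial>M)"
    by (simp only: X exp_add[symmetric] of_real_add distrib_left)
  also have "\<dots> = iexp (u * \<mu>) * (\<integral>\<omega>. iexp ((u * \<sigma>) * Y \<omega>) \<partial>M)"
    by (rule integral_mult_right_zero)
  also have "(\<integral>\<omega>. iexp ((u * \<sigma>) * Y \<omega>) \<partial>M) = char std_normal_distribution (u * \<sigma>)"
    unfolding Ydistr[symmetric] char_def by (subst integral_distr) auto
  also have "\<dots> = of_real (exp (- (u\<^sup>2 * \<sigma>\<^sup>2) / 2))"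
    by (simp add: char_std_normal_distribution power_mult_distrib)
  finally show ?thesis .
qed

text \<open>Real and imaginary part are independent with variance \<open>1/2\<close> each, so that the second moment of the
modulus is one.\<close>

definition std_complex_normal :: "complex measure" where
  "std_complex_normal = density lborel (\<lambda>z. ennreal (exp (- (cmod z)\<^sup>2) / pi))"

lemma std_complex_normal_eq_distr:
  defines "N \<equiv> density lborel (\<lambda>x. ennreal (normal_density 0 (sqrt (1/2)) x))"
  shows "std_complex_normal = distr (N \<Otimes>\<^sub>M N) borel (\<lambda>(x, y). of_real x + \<i> * of_real y)"
proof -
  have N: "prob_space N" unfolding N_def by (rule prob_space_normal_density) simp
  have "std_complex_normal = distr (density (lborel \<Otimes>\<^sub>M lborel)
      (\<lambda>p. ennreal (exp (- (cmod (case p of (x, y) \<Rightarrow> of_real x + \<i> * of_real y))\<^sup>2) / pi)))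
      borel (\<lambda>(x, y). of_real x + \<i> * of_real y)"
    unfolding std_complex_normal_def
    by (subst lborel_complex_eq_distr, subst density_distr) auto
  also have "density (lborel \<Otimes>\<^sub>M lborel)
      (\<lambda>p. ennreal (exp (- (cmod (case p of (x, y) \<Rightarrow> of_real x + \<i> * of_real y))\<^sup>2) / pi)) =
      density (lborel \<Otimes>\<^sub>M lborel) (\<lambda>(x, y). ennreal (normal_density 0 (sqrt (1/2)) x) *
         ennreal (normal_density 0 (sqrt (1/2)) y))"
    by (intro arg_cong2[where f = density] refl ext)
       (auto simp: normal_density_def cmod_power2 ennreal_mult'[symmetric] exp_add[symmetric]
          real_sqrt_mult[symmetric] power_divide field_simps)
  also have "\<dots> = N \<Otimes>\<^sub>M N"
    unfolding N_def
    by (rule pair_measure_density[symmetric])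
       (auto intro: lborel.sigma_finite_measure_axioms prob_space_imp_sigma_finite N[unfolded N_def])
  finally show ?thesis .
qed

lemma prob_space_std_complex_normal: "prob_space std_complex_normal"
proof -
  define N where "N = density lborel (\<lambda>x. ennreal (normal_density 0 (sqrt (1/2)) x))"
  have N: "prob_space N" unfolding N_def by (rule prob_space_normal_density) simp
  have [measurable_cong]: "sets N = sets borel" by (simp add: N_def)
  interpret NN: pair_prob_space N N using N by
      (simp add: pair_prob_space_def pair_sigma_finite_def prob_space_imp_sigma_finite)
  show ?thesis
    unfolding std_complex_normal_eq_distr N_def[symmetric] by (rule NN.prob_space_distr) simp
qed

lemma integral_iexp_std_complex_normal:
  "(\<integral>z. iexp (b \<bullet> z) \<partial>std_complex_normal) = of_real (exp (- (cmod b)\<^sup>2 / 4))"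
proof -
  define N where "N = density lborel (\<lambda>x. ennreal (normal_density 0 (sqrt (1/2)) x))"
  interpret N: prob_space N unfolding N_def by (rule prob_space_normal_density) simp
  interpret NN: pair_sigma_finite N N
    by (simp add: pair_sigma_finite_def N.sigma_finite_measure_axioms)
  have [measurable_cong]: "sets N = sets borel" by (simp add: N_def)
  have ch: "(\<integral>x. iexp (u * x) \<partial>N) = of_real (exp (- u\<^sup>2 / 4))" for u
    using N.expectation_iexp_normal[of "sqrt (1/2)" "\<lambda>x. x" 0 u]
    by (simp add: distributed_def N_def distr_id2 power_divide)
  have "(\<integral>z. iexp (b \<bullet> z) \<partial>std_complex_normal) =
      (\<integral>z. iexp (Re b * fst z) * iexp (Im b * snd z) \<partial>(N \<Otimes>\<^sub>M N))"
    unfolding std_complex_normal_eq_distr N_def[symmetric]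
    by (subst integral_distr)
       (auto simp: inner_complex_def exp_add[symmetric] distrib_left split: prod.splits intro!:
           Bochner_Integration.integral_cong)
  also have "\<dots> = (\<integral>x. iexp (Re b * x) \<partial>N) * (\<integral>y. iexp (Im b * y) \<partial>N)"
    by (rule NN.integral_pair_mult) (auto intro!: N.integrable_const_bound[of _ 1])
  also have "\<dots> = of_real (exp (- (Re b)\<^sup>2 / 4) * exp (- (Im b)\<^sup>2 / 4))"
    unfolding ch by simp
  also have "\<dots> = of_real (exp (- (cmod b)\<^sup>2 / 4))"
    unfolding exp_add[symmetric] cmod_power2 by (simp add: field_simps)
  finally show ?thesis .
qed

lemma (in prob_space) distr_eq_std_complex_normal:
  assumes [measurable]: "Z \<in> borel_measurable M"
    and ch: "\<And>b. (\<integral>\<omega>. iexp (b \<bullet> Z \<omega>) \<partial>M) = of_real (exp (- (cmod b)\<^sup>2 / 4))"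
  shows "distr M borel Z = std_complex_normal"
proof (rule fourier_equal_imp_eq_complex)
  interpret D: prob_space "distr M borel Z" by (rule prob_space_distr) simp
  interpret S: prob_space std_complex_normal by (rule prob_space_std_complex_normal)
  show "fourier_equal (distr M borel Z) std_complex_normal"
    unfolding fourier_equal_def
    using D.finite_measure_axioms S.finite_measure_axioms
    by (auto simp: integral_iexp_std_complex_normal integral_distr ch)
        (simp_all add: std_complex_normal_def)
qed

lemma (in prob_space) distr_pair_eq_std_complex_normal:
  assumes [measurable]: "Z\<^sub>1 \<in> borel_measurable M" "Z\<^sub>2 \<in> borel_measurable M"
    and ch: "\<And>b\<^sub>1 b\<^sub>2. (\<integral>\<omega>. iexp (b\<^sub>1 \<bullet> Z\<^sub>1 \<omega> + b\<^sub>2 \<bullet> Z\<^sub>2 \<omega>) \<partial>M) =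
           of_real (exp (- ((cmod b\<^sub>1)\<^sup>2 + (cmod b\<^sub>2)\<^sup>2) / 4))"
  shows "distr M (borel \<Otimes>\<^sub>M borel) (\<lambda>\<omega>. (Z\<^sub>1 \<omega>, Z\<^sub>2 \<omega>)) = std_complex_normal \<Otimes>\<^sub>M std_complex_normal"
proof (rule fourier_equal_imp_eq_prod)
  interpret D: prob_space "distr M (borel \<Otimes>\<^sub>M borel) (\<lambda>\<omega>. (Z\<^sub>1 \<omega>, Z\<^sub>2 \<omega>))"
    by (rule prob_space_distr) simp
  have S: "prob_space std_complex_normal" by (rule prob_space_std_complex_normal)
  have sets[measurable_cong]: "sets std_complex_normal = sets borel"
    by (simp add: std_complex_normal_def)
  interpret SS: pair_prob_space std_complex_normal std_complex_normal
    using S by (simp add: pair_prob_space_def pair_sigma_finite_def prob_space_imp_sigma_finite)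
  have "(\<integral>z. iexp (v \<bullet> z) \<partial>(std_complex_normal \<Otimes>\<^sub>M std_complex_normal)) =
     of_real (exp (- ((cmod (fst v))\<^sup>2 + (cmod (snd v))\<^sup>2) / 4))" for v
  proof -
    have "(\<integral>z. iexp (v \<bullet> z) \<partial>(std_complex_normal \<Otimes>\<^sub>M std_complex_normal)) =
      (\<integral>z. iexp (fst v \<bullet> fst z) * iexp (snd v \<bullet> snd z) \<partial>(std_complex_normal \<Otimes>\<^sub>M std_complex_normal))"
      by (simp add: inner_prod_def exp_add[symmetric] distrib_left)
    also have "\<dots> = (\<integral>x. iexp (fst v \<bullet> x) \<partial>std_complex_normal)
        * (\<integral>y. iexp (snd v \<bullet> y) \<partial>std_complex_normal)"
      by (rule SS.integral_pair_mult) (auto intro!: SS.M1.integrable_const_bound[of _ 1])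
    also have "\<dots> = of_real (exp (- (cmod (fst v))\<^sup>2 / 4) * exp (- (cmod (snd v))\<^sup>2 / 4))"
      by (simp add: integral_iexp_std_complex_normal)
    also have "\<dots> = of_real (exp (- ((cmod (fst v))\<^sup>2 + (cmod (snd v))\<^sup>2) / 4))"
      unfolding exp_add[symmetric] by (simp add: field_simps)
    finally show ?thesis .
  qed
  moreover have "(\<integral>z. iexp (v \<bullet> z) \<partial>distr M (borel \<Otimes>\<^sub>M borel) (\<lambda>\<omega>. (Z\<^sub>1 \<omega>, Z\<^sub>2 \<omega>))) =
     of_real (exp (- ((cmod (fst v))\<^sup>2 + (cmod (snd v))\<^sup>2) / 4))" for v
    using ch[of "fst v" "snd v"] by (subst integral_distr) (auto simp: inner_prod_def)
  ultimately show "fourier_equal (distr M (borel \<Otimes>\<^sub>M borel) (\<lambda>\<omega>. (Z\<^sub>1 \<omega>, Z\<^sub>2 \<omega>)))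
      (std_complex_normal \<Otimes>\<^sub>M std_complex_normal)"
    unfolding fourier_equal_def
    using D.finite_measure_axioms SS.finite_measure_axioms sets_pair_measure_cong[OF sets sets]
    unfolding borel_prod by simp
qed (rule fourier_equal_imp_eq_complex, assumption)+

section \<open>Centred normal variables\<close>

lemma cmod_iexp_diff_le: "cmod (iexp a - iexp b) \<le> \<bar>a - b\<bar>"
proof -
  have "iexp a - iexp b = iexp b * (iexp (a - b) - 1)"
    by (simp add: exp_diff field_simps)
  then have "cmod (iexp a - iexp b) = cmod (iexp (a - b) - 1)"
    by (simp add: norm_mult)
  also have "\<dots> \<le> \<bar>a - b\<bar>"
    using iexp_approx1[of "a - b" 0] by simp
  finally show ?thesis .
qed

lemma (in prob_space) normal_rv_square_integrable:
  assumes "normal_rv M X"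
  shows "X \<in> borel_measurable M" and "integrable M (\<lambda>\<omega>. (X \<omega>)\<^sup>2)"
proof -
  have "X \<in> borel_measurable M \<and> integrable M (\<lambda>\<omega>. (X \<omega>)\<^sup>2)"
    using assms unfolding normal_rv_def
  proof (elim disjE exE conjE)
    fix \<mu> \<sigma> :: real
    assume \<sigma>: "\<sigma> > 0" and D: "distributed M lborel X (\<lambda>x. ennreal (normal_density \<mu> \<sigma> x))"
    have "integrable lborel (\<lambda>x. normal_density \<mu> \<sigma> x * (x - \<mu>)^2
        + 2 * \<mu> * (normal_density \<mu> \<sigma> x * (x - \<mu>)^1) + \<mu>\<^sup>2 * (normal_density \<mu> \<sigma> x * (x - \<mu>)^0))"
      by (intro Bochner_Integration.integrable_add integrable_mult_right integrable_normal_moment \<sigma>)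
    also have "(\<lambda>x. normal_density \<mu> \<sigma> x * (x - \<mu>)^2
        + 2 * \<mu> * (normal_density \<mu> \<sigma> x * (x - \<mu>)^1) + \<mu>\<^sup>2 * (normal_density \<mu> \<sigma> x * (x - \<mu>)^0)) =
        (\<lambda>x. normal_density \<mu> \<sigma> x * x\<^sup>2)"
      by (auto simp: fun_eq_iff algebra_simps power2_eq_square)
    finally show "X \<in> borel_measurable M \<and> integrable M (\<lambda>\<omega>. (X \<omega>)\<^sup>2)"
      using distributed_integrable[OF D, of "\<lambda>x. x\<^sup>2"] distributed_measurable[OF D] by simp
  next
    fix \<mu> assume X[measurable]: "X \<in> borel_measurable M" and ae: "AE \<omega> in M. X \<omega> = \<mu>"
    have "integrable M (\<lambda>\<omega>. (X \<omega>)\<^sup>2) \<longleftrightarrow> integrable M (\<lambda>\<omega>. \<mu>\<^sup>2)"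
      by (rule integrable_cong_AE) (use ae in auto)
    with X show "X \<in> borel_measurable M \<and> integrable M (\<lambda>\<omega>. (X \<omega>)\<^sup>2)" by simp
  qed
  then show "X \<in> borel_measurable M" "integrable M (\<lambda>\<omega>. (X \<omega>)\<^sup>2)" by auto
qed

lemma (in prob_space) expectation_iexp_centered_normal_rv:
  assumes "normal_rv M X" and mean: "expectation X = 0"
  shows "(\<integral>\<omega>. iexp (X \<omega>) \<partial>M) = of_real (exp (- expectation (\<lambda>\<omega>. (X \<omega>)\<^sup>2) / 2))"
  using assms(1) unfolding normal_rv_def
proof (elim disjE exE conjE)
  fix \<mu> \<sigma> :: real
  assume \<sigma>: "\<sigma> > 0" and D: "distributed M lborel X (\<lambda>x. ennreal (normal_density \<mu> \<sigma> x))"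
  have "\<mu> = 0" "expectation (\<lambda>\<omega>. (X \<omega>)\<^sup>2) = \<sigma>\<^sup>2"
    using normal_distributed_expectation[OF \<sigma> D] normal_distributed_variance[OF \<sigma> D] mean by simp_all
  then show ?thesis using expectation_iexp_normal[OF \<sigma> D, of 1] by simp
next
  fix \<mu> assume X[measurable]: "X \<in> borel_measurable M" and ae: "AE \<omega> in M. X \<omega> = \<mu>"
  have "expectation X = expectation (\<lambda>_. \<mu>)" by (rule integral_cong_AE) (use ae in auto)
  then have "\<mu> = 0" using mean by (simp add: prob_space)
  then have ae: "AE \<omega> in M. X \<omega> = 0" using ae by simp
  have "expectation (\<lambda>\<omega>. (X \<omega>)\<^sup>2) = expectation (\<lambda>_. 0)" by (rule integral_cong_AE) (use ae in auto)
  moreover have "(\<integral>\<omega>. iexp (X \<omega>) \<partial>M) = (\<integral>\<omega>. 1 \<partial>M)" by (rule integral_cong_AE) (use ae in auto)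
  ultimately show ?thesis by (simp add: prob_space)
qed

lemma integrable_mult_square:
  fixes f g :: "'a \<Rightarrow> real"
  assumes [measurable]: "f \<in> borel_measurable M" "g \<in> borel_measurable M"
    and sq: "integrable M (\<lambda>x. (f x)\<^sup>2)" "integrable M (\<lambda>x. (g x)\<^sup>2)"
  shows "integrable M (\<lambda>x. f x * g x)"
proof (rule Bochner_Integration.integrable_bound[OF Bochner_Integration.integrable_add[OF sq]])
  have "\<bar>f x * g x\<bar> \<le> (f x)\<^sup>2 + (g x)\<^sup>2" for x
  proof -
    have "2 * \<bar>f x * g x\<bar> \<le> (f x)\<^sup>2 + (g x)\<^sup>2"
      using sum_squares_bound[of "\<bar>f x\<bar>" "\<bar>g x\<bar>"] by (simp add: abs_mult)
    then show ?thesis using abs_ge_zero[of "f x * g x"] by linarith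
  qed
  then show "AE x in M. norm (f x * g x) \<le> norm ((f x)\<^sup>2 + (g x)\<^sup>2)" by simp
qed simp

text \<open>The variance of \<open>\<bar>X\<bar>\<close> is nonnegative.\<close>

lemma (in prob_space) expectation_abs_le_sqrt:
  fixes X :: "'a \<Rightarrow> real"
  assumes [measurable]: "X \<in> borel_measurable M" and sq: "integrable M (\<lambda>\<omega>. (X \<omega>)\<^sup>2)"
  shows "expectation (\<lambda>\<omega>. \<bar>X \<omega>\<bar>) \<le> sqrt (expectation (\<lambda>\<omega>. (X \<omega>)\<^sup>2))"
proof -
  have "integrable M X" by (rule square_integrable_imp_integrable) (use sq in auto)
  then have "0 \<le> expectation (\<lambda>\<omega>. (X \<omega>)\<^sup>2) - (expectation (\<lambda>\<omega>. \<bar>X \<omega>\<bar>))\<^sup>2"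
    using variance_positive[of "\<lambda>\<omega>. \<bar>X \<omega>\<bar>"] sq by (subst (asm) variance_eq) auto
  then show ?thesis by (intro real_le_rsqrt) simp
qed

section \<open>Path integrals of second order processes\<close>

text \<open>The codomain is generic because real weights are needed for normality and complex ones for the
wavelet coefficients.\<close>

definition process_integral ::
    "(real \<Rightarrow> 'a \<Rightarrow> real) \<Rightarrow> (real \<Rightarrow> 'b) \<Rightarrow> 'a \<Rightarrow> 'b::{real_normed_field, banach,
        second_countable_topology}" where
  "process_integral X h \<omega> = (\<integral>\<tau>. h \<tau> * of_real (X \<tau> \<omega>) \<partial>lborel)"

text \<open>Besides the given process, this covers its time discretisations and their distance to it, for which
the same interchange of integrals is needed.\<close>

locale second_order_process = prob_space +
  fixes X :: "real \<Rightarrow> 'a \<Rightarrow> real" and B :: real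
  assumes jointly_measurable: "(\<lambda>(t, \<omega>). X t \<omega>) \<in> borel_measurable (lborel \<Otimes>\<^sub>M M)"
    and square_integrable: "\<And>t. integrable M (\<lambda>\<omega>. (X t \<omega>)\<^sup>2)"
    and second_moment_le: "\<And>t. expectation (\<lambda>\<omega>. (X t \<omega>)\<^sup>2) \<le> B"
begin

lemma measurable_process [measurable (raw)]:
  assumes "f \<in> borel_measurable N" "g \<in> N \<rightarrow>\<^sub>M M"
  shows "(\<lambda>z. X (f z) (g z)) \<in> borel_measurable N"
  using measurable_compose[OF measurable_Pair[of f N lborel g M] jointly_measurable] assms by simp

lemma process_integrable: "integrable M (X t)"
  by (rule square_integrable_imp_integrable) (auto simp: square_integrable)

lemma bound_nonneg: "0 \<le> B"
  using second_moment_le[of 0] by (rule order_trans[rotated]) simp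

lemma expectation_abs_le: "expectation (\<lambda>\<omega>. \<bar>X t \<omega>\<bar>) \<le> sqrt B"
  by (rule order_trans[OF expectation_abs_le_sqrt])
     (auto simp: square_integrable second_moment_le)

lemma process_mult_integrable: "integrable M (\<lambda>\<omega>. X x \<omega> * X y \<omega>)"
  and expectation_abs_mult_le: "expectation (\<lambda>\<omega>. \<bar>X x \<omega> * X y \<omega>\<bar>) \<le> B"
proof -
  have le: "\<bar>X x \<omega> * X y \<omega>\<bar> \<le> ((X x \<omega>)\<^sup>2 + (X y \<omega>)\<^sup>2) / 2" for \<omega>
    using sum_squares_bound[of "\<bar>X x \<omega>\<bar>" "\<bar>X y \<omega>\<bar>"] by (simp add: abs_mult)
  have i: "integrable M (\<lambda>\<omega>. ((X x \<omega>)\<^sup>2 + (X y \<omega>)\<^sup>2) / 2)"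
    by (simp add: square_integrable)
  show *: "integrable M (\<lambda>\<omega>. X x \<omega> * X y \<omega>)"
    by (rule integrable_mult_square) (auto simp: square_integrable)
  have "expectation (\<lambda>\<omega>. \<bar>X x \<omega> * X y \<omega>\<bar>) \<le> expectation (\<lambda>\<omega>. ((X x \<omega>)\<^sup>2 + (X y \<omega>)\<^sup>2) / 2)"
    by (rule integral_mono) (use le * i in auto)
  also have "\<dots> \<le> B"
    using second_moment_le[of x] second_moment_le[of y] by (simp add: square_integrable)
  finally show "expectation (\<lambda>\<omega>. \<bar>X x \<omega> * X y \<omega>\<bar>) \<le> B" .
qed

lemma process_integral_measurable [measurable]:
  fixes h :: "real \<Rightarrow> 'b::{real_normed_field, banach, second_countable_topology}"
  assumes [measurable]: "h \<in> borel_measurable borel"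
  shows "process_integral X h \<in> borel_measurable M"
  unfolding process_integral_def by measurable

lemma
  fixes h :: "real \<Rightarrow> 'b::{real_normed_field, banach, second_countable_topology}"
  assumes h: "integrable lborel h"
  shows pathwise_integrable: "AE \<omega> in M. integrable lborel (\<lambda>\<tau>. h \<tau> * of_real (X \<tau> \<omega>))"
    and integrable_process_integral: "integrable M (process_integral X h)"
    and expectation_process_integral:
      "integral\<^sup>L M (process_integral X h) = (\<integral>\<tau>. h \<tau> * of_real (expectation (X \<tau>)) \<partial>lborel)"
proof -
  have [measurable]: "h \<in> borel_measurable borel" using h by auto
  interpret LM: pair_sigma_finite lborel M
    by (simp add: pair_sigma_finite_def lborel.sigma_finite_measure_axioms sigma_finite_measure_axioms)
  have int: "integrable (lborel \<Otimes>\<^sub>M M) (\<lambda>(\<tau>, \<omega>). h \<tau> * of_real (X \<tau> \<omega>))"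
  proof (rule LM.Fubini_integrable)
    have "integrable lborel (\<lambda>\<tau>. norm (h \<tau>) * expectation (\<lambda>\<omega>. \<bar>X \<tau> \<omega>\<bar>))"
    proof (rule Bochner_Integration.integrable_bound)
      show "integrable lborel (\<lambda>\<tau>. norm (h \<tau>) * sqrt B)" using h by simp
    qed (auto simp: abs_mult expectation_abs_le bound_nonneg intro!: mult_left_mono)
    then show "integrable lborel (\<lambda>x. \<integral>y. norm (case (x, y) of (\<tau>, \<omega>) \<Rightarrow> h \<tau> * of_real (X \<tau> \<omega>)) \<partial>M)"
      by (simp add: norm_mult)
    show "AE x in lborel. integrable M (\<lambda>y. case (x, y) of (\<tau>, \<omega>) \<Rightarrow> h \<tau> * of_real (X \<tau> \<omega>))"
      using process_integrable by simp
  qed measurable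
  show "AE \<omega> in M. integrable lborel (\<lambda>\<tau>. h \<tau> * of_real (X \<tau> \<omega>))"
    using LM.AE_integrable_snd[OF int] by simp
  show "integrable M (process_integral X h)"
    unfolding process_integral_def[abs_def] using LM.integrable_snd[OF int] by simp
  have "integral\<^sup>L M (process_integral X h) = (\<integral>\<tau>. \<integral>\<omega>. h \<tau> * of_real (X \<tau> \<omega>) \<partial>M \<partial>lborel)"
    unfolding process_integral_def[abs_def] by (rule LM.Fubini_integral[OF int])
  with process_integrable show "integral\<^sup>L M (process_integral X h)
      = (\<integral>\<tau>. h \<tau> * of_real (expectation (X \<tau>)) \<partial>lborel)"
    by simp
qed

lemma
  fixes h\<^sub>1 h\<^sub>2 :: "real \<Rightarrow> 'b::{real_normed_field, banach, second_countable_topology}"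
  assumes h: "integrable lborel h\<^sub>1" "integrable lborel h\<^sub>2"
  shows integrable_process_integral_mult:
      "integrable M (\<lambda>\<omega>. process_integral X h\<^sub>1 \<omega> * process_integral X h\<^sub>2 \<omega>)"
    and expectation_process_integral_mult:
      "(\<integral>\<omega>. process_integral X h\<^sub>1 \<omega> * process_integral X h\<^sub>2 \<omega> \<partial>M) =
       (\<integral>z. h\<^sub>1 (fst z) * h\<^sub>2 (snd z) * of_real (expectation (\<lambda>\<omega>. X (fst z) \<omega> * X (snd z) \<omega>))
          \<partial>(lborel \<Otimes>\<^sub>M lborel))"
proof -
  have [measurable]: "h\<^sub>1 \<in> borel_measurable borel" "h\<^sub>2 \<in> borel_measurable borel" using h by auto
  interpret LM: pair_sigma_finite "lborel \<Otimes>\<^sub>M lborel :: (real \<times> real) measure" M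
    by (simp add: pair_sigma_finite_def sigma_finite_measure_axioms lborel_prod
        lborel.sigma_finite_measure_axioms)
  \<comment> \<open>For almost every \<open>\<omega>\<close>, the product of the two path integrals is a double integral over
    time, which is then interchanged with the expectation.\<close>
  let ?G = "\<lambda>(z, \<omega>). h\<^sub>1 (fst z) * h\<^sub>2 (snd z) * of_real (X (fst z) \<omega> * X (snd z) \<omega>)"
  have int: "integrable ((lborel \<Otimes>\<^sub>M lborel) \<Otimes>\<^sub>M M) ?G"
  proof (rule LM.Fubini_integrable)
    have "integrable (lborel \<Otimes>\<^sub>M lborel)
        (\<lambda>z. norm (h\<^sub>1 (fst z)) * norm (h\<^sub>2 (snd z)) * expectation (\<lambda>\<omega>. \<bar>X (fst z) \<omega> * X (snd z) \<omega>\<bar>))"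
    proof (rule Bochner_Integration.integrable_bound)
      show "integrable (lborel \<Otimes>\<^sub>M lborel) (\<lambda>z. norm (h\<^sub>1 (fst z)) * norm (h\<^sub>2 (snd z)) * B)"
        using lborel_pair.integrable_pair_mult[OF integrable_norm[OF h(1)] integrable_norm[OF h(2)]]
        by simp
    qed (auto simp: abs_mult bound_nonneg intro!:
        mult_left_mono expectation_abs_mult_le[unfolded abs_mult])
    then show "integrable (lborel \<Otimes>\<^sub>M lborel) (\<lambda>z. \<integral>\<omega>. norm (?G (z, \<omega>)) \<partial>M)"
      by (simp add: norm_mult abs_mult)
    show "AE z in lborel \<Otimes>\<^sub>M lborel. integrable M (\<lambda>\<omega>. ?G (z, \<omega>))"
      by (simp add: process_mult_integrable del: of_real_mult)
  qed measurable
  have ae: "AE \<omega> in M. (\<integral>z. ?G (z, \<omega>) \<partial>(lborel \<Otimes>\<^sub>M lborel)) =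
      process_integral X h\<^sub>1 \<omega> * process_integral X h\<^sub>2 \<omega>"
    using pathwise_integrable[OF h(1)] pathwise_integrable[OF h(2)]
  proof eventually_elim
    case (elim \<omega>)
    from lborel_pair.integral_pair_mult[OF elim] show ?case
      by (simp add: process_integral_def mult_ac)
  qed
  have "integrable M (\<lambda>\<omega>. \<integral>z. ?G (z, \<omega>) \<partial>(lborel \<Otimes>\<^sub>M lborel))"
    using LM.integrable_snd[OF int] by simp
  then show "integrable M (\<lambda>\<omega>. process_integral X h\<^sub>1 \<omega> * process_integral X h\<^sub>2 \<omega>)"
    by (rule integrable_cong_AE_imp) (use ae in \<open>auto elim!: eventually_mono\<close>)
  have "(\<integral>\<omega>. process_integral X h\<^sub>1 \<omega> * process_integral X h\<^sub>2 \<omega> \<partial>M) =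
      (\<integral>\<omega>. \<integral>z. ?G (z, \<omega>) \<partial>(lborel \<Otimes>\<^sub>M lborel) \<partial>M)"
    by (rule integral_cong_AE) (use ae in \<open>auto elim!: eventually_mono\<close>)
  also have "\<dots> = (\<integral>z. \<integral>\<omega>. ?G (z, \<omega>) \<partial>M \<partial>(lborel \<Otimes>\<^sub>M lborel))"
    using LM.Fubini_integral[OF int] by simp
  also have "\<dots> = (\<integral>z. h\<^sub>1 (fst z) * h\<^sub>2 (snd z) * of_real (expectation (\<lambda>\<omega>. X (fst z) \<omega> * X (snd z) \<omega>))
          \<partial>(lborel \<Otimes>\<^sub>M lborel))"
    by (simp add: process_mult_integrable del: of_real_mult)
  finally show "(\<integral>\<omega>. process_integral X h\<^sub>1 \<omega> * process_integral X h\<^sub>2 \<omega> \<partial>M) =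
       (\<integral>z. h\<^sub>1 (fst z) * h\<^sub>2 (snd z) * of_real (expectation (\<lambda>\<omega>. X (fst z) \<omega> * X (snd z) \<omega>))
          \<partial>(lborel \<Otimes>\<^sub>M lborel))" .
qed

end

text \<open>The function \<open>iexp\<close> is Lipschitz with constant one.\<close>

lemma (in prob_space) expectation_iexp_L1_limit:
  fixes Z :: "'a \<Rightarrow> real" and Y :: "nat \<Rightarrow> 'a \<Rightarrow> real"
  assumes Y: "\<And>n. integrable M (Y n)" and Z: "integrable M Z"
    and lim: "(\<lambda>n. expectation (\<lambda>\<omega>. \<bar>Y n \<omega> - Z \<omega>\<bar>)) \<longlonglongrightarrow> 0"
  shows "(\<lambda>n. \<integral>\<omega>. iexp (Y n \<omega>) \<partial>M) \<longlonglongrightarrow> (\<integral>\<omega>. iexp (Z \<omega>) \<partial>M)"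
proof -
  have [measurable]: "Y n \<in> borel_measurable M" "Z \<in> borel_measurable M" for n
    using Y Z by auto
  have i: "integrable M (\<lambda>\<omega>. iexp (f \<omega>))" if [measurable]: "f \<in> borel_measurable M" for f
    by (rule integrable_const_bound[of _ 1]) auto
  have "(\<lambda>n. (\<integral>\<omega>. iexp (Y n \<omega>) \<partial>M) - (\<integral>\<omega>. iexp (Z \<omega>) \<partial>M)) \<longlonglongrightarrow> 0"
  proof (rule tendsto_norm_zero_cancel, rule tendsto_sandwich[OF _ _ tendsto_const lim])
    show "\<forall>\<^sub>F n in sequentially. cmod ((\<integral>\<omega>. iexp (Y n \<omega>) \<partial>M) - (\<integral>\<omega>. iexp (Z \<omega>) \<partial>M))
        \<le> expectation (\<lambda>\<omega>. \<bar>Y n \<omega> - Z \<omega>\<bar>)"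
    proof (rule always_eventually, rule allI)
      fix n
      have "cmod ((\<integral>\<omega>. iexp (Y n \<omega>) \<partial>M) - (\<integral>\<omega>. iexp (Z \<omega>) \<partial>M)) =
          cmod (\<integral>\<omega>. iexp (Y n \<omega>) - iexp (Z \<omega>) \<partial>M)"
        by (subst Bochner_Integration.integral_diff) (auto intro: i)
      also have "\<dots> \<le> expectation (\<lambda>\<omega>. cmod (iexp (Y n \<omega>) - iexp (Z \<omega>)))"
        by (rule integral_norm_bound)
      also have "\<dots> \<le> expectation (\<lambda>\<omega>. \<bar>Y n \<omega> - Z \<omega>\<bar>)"
        by (rule integral_mono) (auto intro!:
            cmod_iexp_diff_le Y Z i Bochner_Integration.integrable_diff integrable_norm integrable_abs)
      finally show "cmod ((\<integral>\<omega>. iexp (Y n \<omega>) \<partial>M) - (\<integral>\<omega>. iexp (Z \<omega>) \<partial>M))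
        \<le> expectation (\<lambda>\<omega>. \<bar>Y n \<omega> - Z \<omega>\<bar>)" .
    qed
  qed simp
  then show ?thesis by (rule LIM_zero_cancel)
qed

section \<open>Stationary Gaussian processes and analytic weights\<close>

text \<open>The kernel of the wavelet transform is a conjugated and dilated wavelet.  Conjugation reflects
the spectrum, and the sign in \<open>iexp (l * \<tau>)\<close> reflects it back, so the excluded frequencies are
again the nonpositive ones.\<close>

definition analytic_weight :: "(real \<Rightarrow> complex) \<Rightarrow> bool" where
  "analytic_weight h \<longleftrightarrow> integrable lborel h \<and> (\<forall>l\<le>0. (\<integral>\<tau>. h \<tau> * iexp (l * \<tau>) \<partial>lborel) = 0)"

locale stationary_gaussian = prob_space +
  fixes X :: "real \<Rightarrow> 'a \<Rightarrow> real" and C :: "real \<Rightarrow> real" and F :: "real measure"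
  assumes stationary: "stationary_gaussian_process M X C"
    and spectral: "spectral_measure F C"
begin

lemma normal_rv_linear_combination: "finite I \<Longrightarrow> normal_rv M (\<lambda>\<omega>. \<Sum>t\<in>I. c t * X t \<omega>)"
  using stationary by (auto simp: stationary_gaussian_process_def gaussian_process_def)

lemma normal_rv_process: "normal_rv M (X t)"
  using normal_rv_linear_combination[of "{t}" "\<lambda>_. 1"] by simp

definition \<mu> :: real where "\<mu> = expectation (X 0)"

lemma mean: "expectation (X t) = \<mu>"
  using stationary by (auto simp: stationary_gaussian_process_def \<mu>_def)

lemma expectation_process_mult: "expectation (\<lambda>\<omega>. X s \<omega> * X t \<omega>) = C (s - t) + \<mu>\<^sup>2"
proof -
  have m[measurable]: "X u \<in> borel_measurable M" for u
    by (rule normal_rv_square_integrable(1)[OF normal_rv_process])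
  have sq: "integrable M (\<lambda>\<omega>. (X u \<omega>)\<^sup>2)" for u
    by (rule normal_rv_square_integrable(2)[OF normal_rv_process])
  have i: "integrable M (X u)" for u
    by (rule square_integrable_imp_integrable[OF m sq])
  have i2: "integrable M (\<lambda>\<omega>. X s \<omega> * X t \<omega>)"
    by (rule integrable_mult_square[OF m m sq sq])
  have "C (s - t) = expectation (\<lambda>\<omega>. (X s \<omega> - \<mu>) * (X t \<omega> - \<mu>))"
    using stationary by (simp add: stationary_gaussian_process_def covariance_def mean)
  also have "\<dots> = expectation (\<lambda>\<omega>. X s \<omega> * X t \<omega> - \<mu> * X s \<omega> - \<mu> * X t \<omega> + \<mu>\<^sup>2)"
    by (rule Bochner_Integration.integral_cong) (auto simp: algebra_simps power2_eq_square)
  also have "\<dots> = expectation (\<lambda>\<omega>. X s \<omega> * X t \<omega>) - \<mu>\<^sup>2"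
    using i i2 by (simp add: mean prob_space power2_eq_square)
  finally show ?thesis by simp
qed

lemma second_order: "second_order_process M X (C 0 + \<mu>\<^sup>2)"
proof
  show "(\<lambda>(t, \<omega>). X t \<omega>) \<in> borel_measurable (lborel \<Otimes>\<^sub>M M)"
    using stationary by (simp add: stationary_gaussian_process_def)
  show "integrable M (\<lambda>\<omega>. (X t \<omega>)\<^sup>2)" for t
    by (rule normal_rv_square_integrable(2)[OF normal_rv_process])
  show "expectation (\<lambda>\<omega>. (X t \<omega>)\<^sup>2) \<le> C 0 + \<mu>\<^sup>2" for t
    using expectation_process_mult[of t t] by (simp add: power2_eq_square)
qed

sublocale second_order_process M X "C 0 + \<mu>\<^sup>2"
  by (rule second_order)

lemma
  shows sets_F [measurable_cong]: "sets F = sets borel"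
    and finite_measure_F: "finite_measure F"
    and covariance_eq: "complex_of_real (C t) = (\<integral>l. iexp (l * t) \<partial>F)"
proof -
  show sF: "sets F = sets borel" using spectral by (simp add: spectral_measure_def)
  then have "space F = UNIV" by (auto dest: sets_eq_imp_space_eq)
  then show "finite_measure F"
    using spectral by (intro finite_measureI) (simp add: spectral_measure_def)
  show "complex_of_real (C t) = (\<integral>l. iexp (l * t) \<partial>F)"
    using spectral by (simp add: spectral_measure_def mult.assoc)
qed

lemma integrable_F: "integrable F (\<lambda>l. iexp (l * t))"
proof -
  interpret finite_measure F by (rule finite_measure_F)
  show ?thesis by (rule integrable_const_bound[of _ 1]) auto
qed

lemma covariance_continuous: "isCont C t"
proof -
  have "isCont (\<lambda>t. \<integral>l. iexp (l * t) \<partial>F) t"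
    unfolding continuous_at_sequentially comp_def
  proof (intro allI impI)
    fix x :: "nat \<Rightarrow> real" assume x: "x \<longlonglongrightarrow> t"
    interpret finite_measure F by (rule finite_measure_F)
    show "(\<lambda>n. \<integral>l. iexp (l * x n) \<partial>F) \<longlonglongrightarrow> (\<integral>l. iexp (l * t) \<partial>F)"
      by (rule integral_dominated_convergence[where w = "\<lambda>_. 1"])
         (auto intro!: tendsto_intros x)
  qed
  then have "isCont (\<lambda>t. Re (\<integral>l. iexp (l * t) \<partial>F)) t"
      by (rule bounded_linear.continuous[OF bounded_linear_Re])
  moreover have "Re (\<integral>l. iexp (l * t) \<partial>F) = C t" for t
    by (metis covariance_eq Re_complex_of_real)
  ultimately show ?thesis by simp
qed

lemma covariance_measurable [measurable]: "C \<in> borel_measurable borel"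
  by (intro borel_measurable_continuous_onI continuous_at_imp_continuous_on ballI covariance_continuous)

lemma abs_covariance_le: "\<bar>C t\<bar> \<le> C 0"
proof -
  have "\<bar>C t\<bar> = cmod (\<integral>l. iexp (l * t) \<partial>F)" by (metis covariance_eq norm_of_real real_norm_def)
  also have "\<dots> \<le> (\<integral>l. cmod (iexp (l * t)) \<partial>F)" by (rule integral_norm_bound)
  also have "\<dots> = (\<integral>l. 1 \<partial>F)" by simp
  also have "\<dots> = C 0"
    using covariance_eq[of 0] by (simp add: scaleR_conv_of_real of_real_eq_iff[symmetric, where 'a
        = complex] del: of_real_eq_iff)
  finally show ?thesis .
qed

lemma covariance_0_nonneg: "0 \<le> C 0"
  using abs_covariance_le[of 0] by simp

text \<open>With the continuity of \<open>C\<close> this is continuity in mean of the process.\<close>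

lemma expectation_abs_increment_le: "expectation (\<lambda>\<omega>. \<bar>X s \<omega> - X t \<omega>\<bar>) \<le> sqrt (2 * (C 0 - C (s - t)))"
proof -
  have "integrable M (\<lambda>\<omega>. (X s \<omega>)\<^sup>2 - 2 * (X s \<omega> * X t \<omega>) + (X t \<omega>)\<^sup>2)"
    by (intro Bochner_Integration.integrable_add Bochner_Integration.integrable_diff
        integrable_mult_right square_integrable process_mult_integrable)
  moreover have e: "(X s \<omega> - X t \<omega>)\<^sup>2 = (X s \<omega>)\<^sup>2 - 2 * (X s \<omega> * X t \<omega>) + (X t \<omega>)\<^sup>2" for \<omega>
    by (simp add: power2_diff)
  ultimately have i: "integrable M (\<lambda>\<omega>. (X s \<omega> - X t \<omega>)\<^sup>2)" by simp
  have "expectation (\<lambda>\<omega>. (X s \<omega> - X t \<omega>)\<^sup>2) = 2 * (C 0 - C (s - t))"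
    unfolding e using expectation_process_mult[of s s] expectation_process_mult[of t t]
        expectation_process_mult[of s t]
    by (simp add: square_integrable process_mult_integrable power2_eq_square[symmetric])
  with expectation_abs_le_sqrt[OF _ i] show ?thesis by simp
qed

text \<open>Freezing the time of the process at a simple function \<open>g n\<close> turns the path integral into a finite
linear combination of values of the process, hence into a normal variable.  As \<open>g n\<close> tends to the
identity, the increments \<open>E \<bar>X (g n \<tau>) - X \<tau>\<bar>\<close> tend to zero by continuity of the covariance, and the
variances converge by dominated convergence.  The condition on \<open>h\<close> makes all means zero.\<close>

lemma expectation_iexp_process_integral:
  fixes h :: "real \<Rightarrow> real"
  assumes h: "integrable lborel h" and h0: "(\<integral>\<tau>. h \<tau> \<partial>lborel) = 0"
  shows "(\<integral>\<omega>. iexp (process_integral X h \<omega>) \<partial>M) =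
     of_real (exp (- expectation (\<lambda>\<omega>. (process_integral X h \<omega>)\<^sup>2) / 2))"
proof -
  have [measurable]: "h \<in> borel_measurable borel" using h by auto
  obtain g :: "nat \<Rightarrow> real \<Rightarrow> real" where g: "\<And>n. simple_function borel (g n)"
      and lim: "\<And>x. (\<lambda>n. g n x) \<longlonglongrightarrow> x"
  proof -
    have "\<exists>g. (\<forall>n. simple_function borel (g n)) \<and> (\<forall>x::real. (\<lambda>n. g n x) \<longlonglongrightarrow> x)"
      using borel_measurable_implies_sequence_metric[of "\<lambda>x::real. x" borel 0] by auto
    then show ?thesis using that by blast
  qed
  have [measurable]: "g n \<in> borel_measurable borel" for n
    using g by (rule borel_measurable_simple_function)
  define Xn where "Xn n \<tau> = X (g n \<tau>)" for n \<tau>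
  define Z where "Z = process_integral X h"
  define Zn where "Zn n = process_integral (Xn n) h" for n
  have Xn: "second_order_process M (Xn n) (C 0 + \<mu>\<^sup>2)" for n
    by unfold_locales (auto simp: Xn_def square_integrable second_moment_le)
  have Z_int: "integrable M Z" unfolding Z_def by (rule integrable_process_integral[OF h])
  have Zn_int: "integrable M (Zn n)" for n
    unfolding Zn_def by (rule second_order_process.integrable_process_integral[OF Xn h])
  have conv: "(\<lambda>n. expectation (\<lambda>\<omega>. \<bar>Zn n \<omega> - Z \<omega>\<bar>)) \<longlonglongrightarrow> 0"
  proof (rule tendsto_sandwich[OF _ _ tendsto_const])
    \<comment> \<open>the bound on the mean increments, weighted by \<open>\<bar>h\<bar>\<close>\<close>
    define b where "b n \<tau> = \<bar>h \<tau>\<bar> * sqrt (2 * (C 0 - C (g n \<tau> - \<tau>)))" for n \<tau>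
    have [measurable]: "b n \<in> borel_measurable borel" for n unfolding b_def by measurable
    have b_le: "\<bar>b n \<tau>\<bar> \<le> \<bar>h \<tau>\<bar> * sqrt (4 * C 0)" for n \<tau>
      using abs_covariance_le[of "g n \<tau> - \<tau>"] unfolding b_def
          by (auto simp: abs_mult intro!: mult_left_mono)
    have hb: "integrable lborel (\<lambda>\<tau>. \<bar>h \<tau>\<bar> * sqrt (4 * C 0))" using h by simp
    show "(\<lambda>n. \<integral>\<tau>. b n \<tau> \<partial>lborel) \<longlonglongrightarrow> 0"
    proof -
      have "(\<lambda>n. \<integral>\<tau>. b n \<tau> \<partial>lborel) \<longlonglongrightarrow> integral\<^sup>L lborel (\<lambda>\<tau>::real. 0::real)"
      proof (rule integral_dominated_convergence[where w = "\<lambda>\<tau>. \<bar>h \<tau>\<bar> * sqrt (4 * C 0)"])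
        have "(\<lambda>n. b n \<tau>) \<longlonglongrightarrow> \<bar>h \<tau>\<bar> * sqrt (2 * (C 0 - C (\<tau> - \<tau>)))" for \<tau>
          unfolding b_def
          by (intro tendsto_intros isCont_tendsto_compose[OF covariance_continuous] lim)
        then show "AE \<tau> in lborel. (\<lambda>n. b n \<tau>) \<longlonglongrightarrow> 0" by simp
      qed (use b_le hb in auto)
      then show ?thesis by simp
    qed
    show "\<forall>\<^sub>F n in sequentially. expectation (\<lambda>\<omega>. \<bar>Zn n \<omega> - Z \<omega>\<bar>) \<le> (\<integral>\<tau>. b n \<tau> \<partial>lborel)"
    proof (rule always_eventually, rule allI)
      fix n
      \<comment> \<open>The distance is itself a process of second order, so its path integral against \<open>\<bar>h\<bar>\<close>
        has an expectation that can be computed under the integral sign.\<close>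
      define D where "D \<tau> \<omega> = \<bar>Xn n \<tau> \<omega> - X \<tau> \<omega>\<bar>" for \<tau> \<omega>
      have D2: "(D \<tau> \<omega>)\<^sup>2 \<le> 2 * (Xn n \<tau> \<omega>)\<^sup>2 + 2 * (X \<tau> \<omega>)\<^sup>2" for \<tau> \<omega>
        using sum_squares_bound[of "Xn n \<tau> \<omega>" "- X \<tau> \<omega>"] by (simp add: D_def power2_diff)
      have [measurable]: "(\<lambda>(t, \<omega>). D t \<omega>) \<in> borel_measurable (lborel \<Otimes>\<^sub>M M)"
        unfolding D_def Xn_def by measurable
      have D2i: "integrable M (\<lambda>\<omega>. (D \<tau> \<omega>)\<^sup>2)" for \<tau>
        by (rule Bochner_Integration.integrable_bound[of _ "\<lambda>\<omega>. 2 * (Xn n \<tau> \<omega>)\<^sup>2 + 2 * (X \<tau> \<omega>)\<^sup>2"])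
           (use D2 in \<open>auto simp: square_integrable D_def Xn_def\<close>)
      have D: "second_order_process M D (4 * (C 0 + \<mu>\<^sup>2))"
      proof
        fix \<tau>
        have "expectation (\<lambda>\<omega>. (D \<tau> \<omega>)\<^sup>2) \<le> expectation (\<lambda>\<omega>. 2 * (Xn n \<tau> \<omega>)\<^sup>2 + 2 * (X \<tau> \<omega>)\<^sup>2)"
          by (rule integral_mono) (use D2 D2i in \<open>auto simp: square_integrable Xn_def\<close>)
        also have "\<dots> \<le> 4 * (C 0 + \<mu>\<^sup>2)"
          using second_moment_le[of "g n \<tau>"] second_moment_le[of \<tau>]
          by (simp add: square_integrable Xn_def)
        finally show "expectation (\<lambda>\<omega>. (D \<tau> \<omega>)\<^sup>2) \<le> 4 * (C 0 + \<mu>\<^sup>2)" .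
      qed (use D2i in auto)
      have habs: "integrable lborel (\<lambda>\<tau>. \<bar>h \<tau>\<bar>)" using h by simp
      have "AE \<omega> in M. \<bar>Zn n \<omega> - Z \<omega>\<bar> \<le> process_integral D (\<lambda>\<tau>. \<bar>h \<tau>\<bar>) \<omega>"
        using pathwise_integrable[OF h] second_order_process.pathwise_integrable[OF Xn h, of n]
      proof eventually_elim
        case (elim \<omega>)
        have "\<bar>Zn n \<omega> - Z \<omega>\<bar> = \<bar>\<integral>\<tau>. h \<tau> * Xn n \<tau> \<omega> - h \<tau> * X \<tau> \<omega> \<partial>lborel\<bar>"
          unfolding Zn_def Z_def process_integral_def
          using elim by (subst Bochner_Integration.integral_diff) auto
        also have "\<dots> \<le> (\<integral>\<tau>. \<bar>h \<tau> * Xn n \<tau> \<omega> - h \<tau> * X \<tau> \<omega>\<bar> \<partial>lborel)"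
          using integral_norm_bound[of lborel "\<lambda>\<tau>. h \<tau> * Xn n \<tau> \<omega> - h \<tau> * X \<tau> \<omega>"] by simp
        also have "\<dots> = process_integral D (\<lambda>\<tau>. \<bar>h \<tau>\<bar>) \<omega>"
          by (simp add: process_integral_def D_def abs_mult[symmetric] right_diff_distrib)
        finally show ?case .
      qed
      then have "expectation (\<lambda>\<omega>. \<bar>Zn n \<omega> - Z \<omega>\<bar>) \<le> expectation (process_integral D (\<lambda>\<tau>. \<bar>h \<tau>\<bar>))"
        using Zn_int Z_int second_order_process.integrable_process_integral[OF D habs]
        by (intro integral_mono_AE) auto
      also have "\<dots> = (\<integral>\<tau>. \<bar>h \<tau>\<bar> * expectation (D \<tau>) \<partial>lborel)"
        using second_order_process.expectation_process_integral[OF D habs] by simp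
      also have "\<dots> \<le> (\<integral>\<tau>. b n \<tau> \<partial>lborel)"
      proof (rule integral_mono')
        show "integrable lborel (b n)"
          by (rule Bochner_Integration.integrable_bound[OF hb])
              (simp_all add: order_trans[OF b_le abs_ge_self])
        show "\<bar>h \<tau>\<bar> * expectation (D \<tau>) \<le> b n \<tau>" for \<tau>
          using expectation_abs_increment_le[of "g n \<tau>" \<tau>]
          by (auto simp: b_def D_def[abs_def] Xn_def intro!: mult_left_mono)
        show "0 \<le> b n \<tau>" for \<tau>
          using abs_covariance_le[of "g n \<tau> - \<tau>"] by (auto simp: b_def)
      qed
      finally show "expectation (\<lambda>\<omega>. \<bar>Zn n \<omega> - Z \<omega>\<bar>) \<le> (\<integral>\<tau>. b n \<tau> \<partial>lborel)" .
    qed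
  qed auto
  have normal: "normal_rv M (Zn n)" for n
  proof -
    define I where "I = range (g n)"
    have I: "finite I" using simple_functionD(1)[OF g[of n]] by (simp add: I_def)
    \<comment> \<open>the total weight of the times that \<open>g n\<close> moves to \<open>v\<close>\<close>
    define c where "c v = (\<integral>\<tau>. h \<tau> * indicator (g n -` {v}) \<tau> \<partial>lborel)" for v
    have gv: "g n -` {v} \<in> sets borel" for v
      using simple_functionD(2)[OF g[of n], of "{v}"] by simp
    have hv: "integrable lborel (\<lambda>\<tau>. h \<tau> * indicator (g n -` {v}) \<tau>)" for v
      using integrable_mult_indicator[of "g n -` {v}" lborel h] h gv by (simp add: mult.commute)
    have "Zn n \<omega> = (\<Sum>v\<in>I. c v * X v \<omega>)" for \<omega>
    proof -
      have "h \<tau> * Xn n \<tau> \<omega> = (\<Sum>v\<in>I. h \<tau> * indicator (g n -` {v}) \<tau> * X v \<omega>)" for \<tau>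
      proof -
        have "(\<Sum>v\<in>I. h \<tau> * indicator (g n -` {v}) \<tau> * X v \<omega>)
            = (\<Sum>v\<in>I. if v = g n \<tau> then h \<tau> * X v \<omega> else 0)"
          by (rule sum.cong) (auto simp: indicator_def)
        also have "\<dots> = h \<tau> * Xn n \<tau> \<omega>" using I by (simp add: I_def Xn_def)
        finally show ?thesis ..
      qed
      then show ?thesis
        using hv by (simp add: Zn_def process_integral_def c_def)
    qed
    then have "Zn n = (\<lambda>\<omega>. \<Sum>v\<in>I. c v * X v \<omega>)" by auto
    then show ?thesis using normal_rv_linear_combination[OF I] by simp
  qed
  have mean0: "expectation (Zn n) = 0" for n
    unfolding Zn_def second_order_process.expectation_process_integral[OF Xn h] Xn_def mean
    using h0 by simp
  have var: "(\<lambda>n. expectation (\<lambda>\<omega>. (Zn n \<omega>)\<^sup>2)) \<longlonglongrightarrow> expectation (\<lambda>\<omega>. (Z \<omega>)\<^sup>2)"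
  proof -
    let ?w = "\<lambda>z. \<bar>h (fst z)\<bar> * \<bar>h (snd z)\<bar> * (C 0 + \<mu>\<^sup>2)"
    have w: "integrable (lborel \<Otimes>\<^sub>M lborel) ?w"
      using lborel_pair.integrable_pair_mult[OF integrable_abs[OF h] integrable_abs[OF h]] by simp
    have "(\<lambda>n. \<integral>z. h (fst z) * h (snd z) * (C (g n (fst z) - g n (snd z)) + \<mu>\<^sup>2) \<partial>(lborel \<Otimes>\<^sub>M lborel))
      \<longlonglongrightarrow> (\<integral>z. h (fst z) * h (snd z) * (C (fst z - snd z) + \<mu>\<^sup>2) \<partial>(lborel \<Otimes>\<^sub>M lborel))"
    proof (rule integral_dominated_convergence[where w = ?w])
      show "integrable (lborel \<Otimes>\<^sub>M lborel) ?w" by (rule w)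
      show "AE z in lborel \<Otimes>\<^sub>M lborel. (\<lambda>n. h (fst z) * h (snd z)
          * (C (g n (fst z) - g n (snd z)) + \<mu>\<^sup>2))
         \<longlonglongrightarrow> h (fst z) * h (snd z) * (C (fst z - snd z) + \<mu>\<^sup>2)"
        by (intro AE_I2 tendsto_intros isCont_tendsto_compose[OF covariance_continuous] lim)
      have "\<bar>C t + \<mu>\<^sup>2\<bar> \<le> C 0 + \<mu>\<^sup>2" for t
        using abs_covariance_le[of t] zero_le_power2[of \<mu>] unfolding abs_le_iff by linarith
      then show "AE z in lborel \<Otimes>\<^sub>M lborel. norm
          (h (fst z) * h (snd z) * (C (g n (fst z) - g n (snd z)) + \<mu>\<^sup>2)) \<le> ?w z" for n
        by (intro AE_I2) (auto simp: abs_mult intro!: mult_left_mono)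
    qed measurable
    moreover have "expectation (\<lambda>\<omega>. (Z \<omega>)\<^sup>2) =
       (\<integral>z. h (fst z) * h (snd z) * (C (fst z - snd z) + \<mu>\<^sup>2) \<partial>(lborel \<Otimes>\<^sub>M lborel))"
      using expectation_process_integral_mult[OF h h]
      by (simp add: Z_def power2_eq_square[of "process_integral X h _"] expectation_process_mult)
    moreover have "expectation (\<lambda>\<omega>. (Zn n \<omega>)\<^sup>2) =
       (\<integral>z. h (fst z) * h (snd z) * (C (g n (fst z) - g n (snd z)) + \<mu>\<^sup>2) \<partial>(lborel \<Otimes>\<^sub>M lborel))" for n
      using second_order_process.expectation_process_integral_mult[OF Xn h h, of n]
      by (simp add: Zn_def power2_eq_square[of "process_integral _ h _"] Xn_def expectation_process_mult)
    ultimately show ?thesis by simp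
  qed
  have "(\<lambda>n. \<integral>\<omega>. iexp (Zn n \<omega>) \<partial>M) \<longlonglongrightarrow> (\<integral>\<omega>. iexp (Z \<omega>) \<partial>M)"
    by (rule expectation_iexp_L1_limit[OF Zn_int Z_int conv])
  moreover have "(\<lambda>n. \<integral>\<omega>. iexp (Zn n \<omega>) \<partial>M) \<longlonglongrightarrow> of_real (exp (- expectation (\<lambda>\<omega>. (Z \<omega>)\<^sup>2) / 2))"
    unfolding expectation_iexp_centered_normal_rv[OF normal mean0]
    by (intro tendsto_intros var) simp
  ultimately show ?thesis unfolding Z_def by (rule LIMSEQ_unique)
qed

text \<open>Substitute the spectral representation of the covariance and interchange the integrals; the
condition on \<open>h\<^sub>1\<close> removes the contribution of the mean of the process.\<close>

lemma expectation_process_integral_mult_eq_spectral: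
  assumes h: "integrable lborel h\<^sub>1" "integrable lborel h\<^sub>2" "(\<integral>\<tau>. h\<^sub>1 \<tau> \<partial>lborel) = 0"
  shows "(\<integral>\<omega>. process_integral X h\<^sub>1 \<omega> * process_integral X h\<^sub>2 \<omega> \<partial>M) =
    (\<integral>l. (\<integral>\<tau>. h\<^sub>1 \<tau> * iexp (l * \<tau>) \<partial>lborel) * (\<integral>\<tau>. h\<^sub>2 \<tau> * iexp (- l * \<tau>) \<partial>lborel) \<partial>F)"
proof -
  have [measurable]: "h\<^sub>1 \<in> borel_measurable borel" "h\<^sub>2 \<in> borel_measurable borel" using h by auto
  interpret FF: finite_measure F by (rule finite_measure_F)
  interpret LF: pair_sigma_finite "lborel \<Otimes>\<^sub>M lborel :: (real \<times> real) measure" F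
    by (simp add: pair_sigma_finite_def FF.sigma_finite_measure_axioms lborel_prod
        lborel.sigma_finite_measure_axioms)
  let ?H = "\<lambda>z. h\<^sub>1 (fst z) * h\<^sub>2 (snd z)"
  have hh: "integrable (lborel \<Otimes>\<^sub>M lborel) ?H" by (rule lborel_pair.integrable_pair_mult[OF h(1,2)])
  have hi: "integrable lborel (\<lambda>\<tau>. h \<tau> * iexp (l * \<tau>))" if "integrable lborel h" for h l
    by (rule Bochner_Integration.integrable_bound[OF that]) (use that in \<open>auto simp: norm_mult\<close>)
  let ?G = "\<lambda>(z, l). ?H z * iexp (l * (fst z - snd z))"
  have int: "integrable ((lborel \<Otimes>\<^sub>M lborel) \<Otimes>\<^sub>M F) ?G"
  proof (rule LF.Fubini_integrable)
    show "integrable (lborel \<Otimes>\<^sub>M lborel) (\<lambda>z. \<integral>l. norm (?G (z, l)) \<partial>F)"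
      using integrable_mult_right[OF integrable_norm[OF hh], of "measure F (space F)"]
      by (simp add: norm_mult mult_ac del: of_real_mult of_real_diff)
    show "AE z in lborel \<Otimes>\<^sub>M lborel. integrable F (\<lambda>l. ?G (z, l))"
      using integrable_F by (simp del: of_real_mult of_real_diff)
  qed measurable
  have i1: "integrable (lborel \<Otimes>\<^sub>M lborel) (\<lambda>z. ?H z * of_real (C (fst z - snd z)))"
    by (rule Bochner_Integration.integrable_bound[OF
        integrable_mult_left[OF integrable_norm[OF hh], of "C 0"]])
       (use abs_covariance_le covariance_0_nonneg in \<open>auto simp: norm_mult intro!: mult_left_mono\<close>)
  have "(\<integral>\<omega>. process_integral X h\<^sub>1 \<omega> * process_integral X h\<^sub>2 \<omega> \<partial>M) =
     (\<integral>z. ?H z * of_real (C (fst z - snd z)) + ?H z * of_real (\<mu>\<^sup>2) \<partial>(lborel \<Otimes>\<^sub>M lborel))"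
    unfolding expectation_process_integral_mult[OF h(1,2)] expectation_process_mult
    by (simp add: distrib_left)
  also have "\<dots> = (\<integral>z. ?H z * of_real (C (fst z - snd z)) \<partial>(lborel \<Otimes>\<^sub>M lborel))
      + (\<integral>z. ?H z \<partial>(lborel \<Otimes>\<^sub>M lborel)) * of_real (\<mu>\<^sup>2)"
    using i1 hh by simp
  also have "(\<integral>z. ?H z \<partial>(lborel \<Otimes>\<^sub>M lborel)) = 0"
    using h(3) by (simp add: lborel_pair.integral_pair_mult[OF h(1,2)])
  also have "(\<integral>z. ?H z * of_real (C (fst z - snd z)) \<partial>(lborel \<Otimes>\<^sub>M lborel)) =
      (\<integral>z. \<integral>l. ?G (z, l) \<partial>F \<partial>(lborel \<Otimes>\<^sub>M lborel))"
    unfolding covariance_eq by (simp del: of_real_mult of_real_diff)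
  also have "\<dots> = (\<integral>l. \<integral>z. ?G (z, l) \<partial>(lborel \<Otimes>\<^sub>M lborel) \<partial>F)"
    using LF.Fubini_integral[OF int] by simp
  also have "\<dots> = (\<integral>l. (\<integral>\<tau>. h\<^sub>1 \<tau> * iexp (l * \<tau>) \<partial>lborel) * (\<integral>\<tau>. h\<^sub>2 \<tau> * iexp (- l * \<tau>) \<partial>lborel) \<partial>F)"
  proof (rule Bochner_Integration.integral_cong[OF refl])
    fix l
    have G: "?G (z, l) = (h\<^sub>1 (fst z) * iexp (l * fst z)) * (h\<^sub>2 (snd z) * iexp (- l * snd z))" for z
    proof -
      have "iexp (l * (fst z - snd z)) = iexp (l * fst z) * iexp (- l * snd z)"
        by (simp add: exp_add[symmetric] right_diff_distrib)
      then show ?thesis by (simp only: prod.case mult_ac)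
    qed
    show "(\<integral>z. ?G (z, l) \<partial>(lborel \<Otimes>\<^sub>M lborel)) =
       (\<integral>\<tau>. h\<^sub>1 \<tau> * iexp (l * \<tau>) \<partial>lborel) * (\<integral>\<tau>. h\<^sub>2 \<tau> * iexp (- l * \<tau>) \<partial>lborel)"
      unfolding G by (rule lborel_pair.integral_pair_mult[OF hi[OF h(1), of l] hi[OF h(2), of "- l"]])
  qed
  finally show ?thesis by simp
qed

text \<open>For every frequency \<open>l\<close>, one of \<open>l\<close> and \<open>- l\<close> is nonpositive, so the spectral integrand vanishes
identically.\<close>

lemma expectation_analytic_mult:
  assumes "analytic_weight h\<^sub>1" "analytic_weight h\<^sub>2"
  shows "(\<integral>\<omega>. process_integral X h\<^sub>1 \<omega> * process_integral X h\<^sub>2 \<omega> \<partial>M) = 0"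
proof -
  have "(\<integral>\<tau>. h\<^sub>1 \<tau> * iexp (0 * \<tau>) \<partial>lborel) = 0"
    using assms(1) by (simp only: analytic_weight_def)
  then have h0: "(\<integral>\<tau>. h\<^sub>1 \<tau> \<partial>lborel) = 0" by simp
  have z: "(\<integral>\<tau>. h\<^sub>1 \<tau> * iexp (l * \<tau>) \<partial>lborel) * (\<integral>\<tau>. h\<^sub>2 \<tau> * iexp (- l * \<tau>) \<partial>lborel) = 0" for l
  proof (cases "l \<le> 0")
    case True
    then have "(\<integral>\<tau>. h\<^sub>1 \<tau> * iexp (l * \<tau>) \<partial>lborel) = 0"
      using assms(1) by (simp only: analytic_weight_def)
    then show ?thesis by (simp only: mult_zero_left)
  next
    case False
    then have "- l \<le> 0" by simp
    then have "(\<integral>\<tau>. h\<^sub>2 \<tau> * iexp (- l * \<tau>) \<partial>lborel) = 0"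
      using assms(2) by (simp only: analytic_weight_def)
    then show ?thesis by (simp only: mult_zero_right)
  qed
  show ?thesis
    using assms unfolding analytic_weight_def
    by (subst expectation_process_integral_mult_eq_spectral) (simp_all only: h0 z, simp)
qed

lemma process_integral_Re:
  assumes h: "integrable lborel h"
  shows "AE \<omega> in M. process_integral X (\<lambda>\<tau>. Re (h \<tau>)) \<omega> = Re (process_integral X h \<omega>)"
  using pathwise_integrable[OF h]
proof eventually_elim
  case (elim \<omega>)
  from integral_Re[OF elim] show ?case by (simp add: process_integral_def)
qed

lemma integrable_cmod_process_integral_square:
  assumes h: "integrable lborel h"
  shows "integrable M (\<lambda>\<omega>. (cmod (process_integral X h \<omega>))\<^sup>2)"
proof -
  have "integrable M (\<lambda>\<omega>. norm (process_integral X h \<omega> * process_integral X h \<omega>))"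
    by (intro integrable_norm integrable_process_integral_mult h)
  then show ?thesis by (simp add: norm_mult power2_eq_square)
qed

text \<open>Since \<open>E (Z\<^sup>2) = 0\<close> for the path integral \<open>Z\<close>, the variance of \<open>Re Z\<close> is half of \<open>E \<bar>Z\<bar>\<^sup>2\<close>.  This is
where the circular symmetry of \<open>Z\<close> enters.\<close>

lemma expectation_iexp_analytic:
  assumes h: "analytic_weight h"
  shows "(\<integral>\<omega>. iexp (Re (process_integral X h \<omega>)) \<partial>M) =
    of_real (exp (- expectation (\<lambda>\<omega>. (cmod (process_integral X h \<omega>))\<^sup>2) / 4))"
proof -
  have hi: "integrable lborel h" using h by (simp add: analytic_weight_def)
  have [measurable]: "h \<in> borel_measurable borel" using hi by auto
  let ?Z = "process_integral X h" and ?R = "process_integral X (\<lambda>\<tau>. Re (h \<tau>))"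
  have "(\<integral>\<tau>. h \<tau> * iexp (0 * \<tau>) \<partial>lborel) = 0"
    using h by (simp only: analytic_weight_def)
  then have "(\<integral>\<tau>. Re (h \<tau>) \<partial>lborel) = 0" using integral_Re[OF hi] by simp
  note c = expectation_iexp_process_integral[OF integrable_Re[OF hi] this]
  have "expectation (\<lambda>\<omega>. (?R \<omega>)\<^sup>2) = expectation (\<lambda>\<omega>. ((cmod (?Z \<omega>))\<^sup>2 + Re (?Z \<omega> * ?Z \<omega>)) / 2)"
  proof (rule integral_cong_AE)
    show "AE \<omega> in M. (?R \<omega>)\<^sup>2 = ((cmod (?Z \<omega>))\<^sup>2 + Re (?Z \<omega> * ?Z \<omega>)) / 2"
      using process_integral_Re[OF hi]
      by eventually_elim (simp add: cmod_power2, simp add: power2_eq_square)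
  qed auto
  also have "\<dots> = expectation (\<lambda>\<omega>. (cmod (?Z \<omega>))\<^sup>2) / 2"
    using integrable_cmod_process_integral_square[OF hi] expectation_analytic_mult[OF h h]
      integral_Re[OF integrable_process_integral_mult[OF hi hi]]
          integrable_Re[OF integrable_process_integral_mult[OF hi hi]]
    by (simp del: times_complex.sel)
  finally have v: "expectation (\<lambda>\<omega>. (?R \<omega>)\<^sup>2) = expectation (\<lambda>\<omega>. (cmod (?Z \<omega>))\<^sup>2) / 2" .
  have "(\<integral>\<omega>. iexp (Re (?Z \<omega>)) \<partial>M) = (\<integral>\<omega>. iexp (?R \<omega>) \<partial>M)"
    by (rule integral_cong_AE) (use process_integral_Re[OF hi] in \<open>auto elim!: eventually_mono\<close>)
  with c v show ?thesis by simp
qed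

end

section \<open>Densities of products\<close>

lemma distributedI_nn_integral:
  assumes [measurable]: "X \<in> M \<rightarrow>\<^sub>M N" "f \<in> borel_measurable N"
    and eq: "\<And>g. g \<in> borel_measurable N \<Longrightarrow> (\<integral>\<^sup>+\<omega>. g (X \<omega>) \<partial>M) = (\<integral>\<^sup>+x. f x * g x \<partial>N)"
  shows "distributed M N X f"
  unfolding distributed_def
proof (intro conjI measure_eqI)
  fix A assume "A \<in> sets (distr M N X)"
  then have [measurable]: "A \<in> sets N" by simp
  have "emeasure (distr M N X) A = (\<integral>\<^sup>+\<omega>. indicator A (X \<omega>) \<partial>M)"
    by (simp add: nn_integral_indicator[symmetric] nn_integral_distr del: nn_integral_indicator)
  also have "\<dots> = (\<integral>\<^sup>+x. f x * indicator A x \<partial>N)" by (rule eq) simp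
  finally show "emeasure (distr M N X) A = emeasure (density N f) A" by (simp add: emeasure_density)
qed simp_all

text \<open>For fixed \<open>u \<noteq> 0\<close> the substitution \<open>v = w / u\<close> has Jacobian \<open>1 / \<bar>u\<bar>\<^sup>2\<close>; the density at \<open>w\<close> is the
integral over \<open>u\<close>, written in polar coordinates.\<close>

lemma distributed_complex_product:
  fixes U V :: "'a \<Rightarrow> complex" and J :: "complex \<times> complex \<Rightarrow> ennreal"
  assumes J: "distributed M (lborel \<Otimes>\<^sub>M lborel) (\<lambda>\<omega>. (U \<omega>, V \<omega>)) J"
  shows "distributed M lborel (\<lambda>\<omega>. U \<omega> * V \<omega>) (\<lambda>w. \<integral>\<^sup>+r\<in>{0<..}. (\<integral>\<^sup>+\<theta>\<in>{0..2 * pi}.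
     ennreal (1 / r) * J (of_real r * exp (\<i> * of_real \<theta>), w * of_real (inverse r)
         * exp (- (\<i> * of_real \<theta>))) \<partial>lborel) \<partial>lborel)"
    (is "distributed M lborel _ ?q")
proof (rule distributedI_nn_integral)
  have [measurable]: "J \<in> borel_measurable (borel \<Otimes>\<^sub>M borel)"
    using distributed_borel_measurable[OF J] by (simp cong: measurable_cong_sets)
  have m: "(\<lambda>\<omega>. (U \<omega>, V \<omega>)) \<in> M \<rightarrow>\<^sub>M borel \<Otimes>\<^sub>M borel"
    using distributed_measurable[OF J] by (simp cong: measurable_cong_sets)
  have [measurable]: "U \<in> borel_measurable M" "V \<in> borel_measurable M"
    using measurable_compose[OF m measurable_fst] measurable_compose[OF m measurable_snd] by simp_all
  show "(\<lambda>\<omega>. U \<omega> * V \<omega>) \<in> M \<rightarrow>\<^sub>M lborel" by simp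
  show "?q \<in> borel_measurable lborel" by measurable
  fix g :: "complex \<Rightarrow> ennreal" assume "g \<in> borel_measurable lborel"
  then have [measurable]: "g \<in> borel_measurable borel" by simp
  have CC: "pair_sigma_finite (lborel :: complex measure) (lborel :: complex measure)"
    by (intro pair_sigma_finite.intro lborel.sigma_finite_measure_axioms)
  have q: "?q w = (\<integral>\<^sup>+u. ennreal (1 / (cmod u)\<^sup>2) * J (u, w / u) \<partial>lborel)" for w
  proof -
    have inner: "(\<integral>\<^sup>+\<theta>\<in>{0..2 * pi}. ennreal (1 / r)
        * J (of_real r * exp (\<i> * of_real \<theta>), w * of_real (inverse r)
            * exp (- (\<i> * of_real \<theta>))) \<partial>lborel) * indicator {0<..} r =
      (\<integral>\<^sup>+\<theta>\<in>{0..2 * pi}. ennreal r * (ennreal (1 / (cmod (of_real r * exp (\<i> * of_real \<theta>)))\<^sup>2) *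
         J (of_real r * exp (\<i> * of_real \<theta>), w / (of_real r * exp (\<i> * of_real \<theta>)))) \<partial>lborel)
             * indicator {0<..} r" for r :: real
    proof (cases "r > 0")
      case True
      let ?u = "\<lambda>\<theta>. of_real r * exp (\<i> * of_real \<theta>) :: complex"
      have "ennreal (1 / r) * J (?u \<theta>, w * of_real (inverse r) * exp (- (\<i> * of_real \<theta>))) =
          ennreal r * (ennreal (1 / (cmod (?u \<theta>))\<^sup>2) * J (?u \<theta>, w / ?u \<theta>))" for \<theta>
      proof -
        have "w * of_real (inverse r) * exp (- (\<i> * of_real \<theta>)) = w / ?u \<theta>"
          by (simp add: exp_minus divide_inverse)
        moreover have "cmod (?u \<theta>) = r" using True by (simp add: norm_mult)
        ultimately show ?thesis
          using True by (simp add: mult.assoc[symmetric] ennreal_mult[symmetric] power2_eq_square)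
      qed
      then show ?thesis by (simp only:)
    qed simp
    show ?thesis
      unfolding inner by (rule nn_integral_complex_polar[symmetric]) simp
  qed
  have "(\<integral>\<^sup>+\<omega>. g (U \<omega> * V \<omega>) \<partial>M) = (\<integral>\<^sup>+z. J z * g (fst z * snd z) \<partial>(lborel \<Otimes>\<^sub>M lborel))"
    by (subst distributed_nn_integral[OF J]) auto
  also have "\<dots> = (\<integral>\<^sup>+u. \<integral>\<^sup>+v. J (u, v) * g (u * v) \<partial>lborel \<partial>lborel)"
    by (subst lborel.nn_integral_fst[symmetric]) auto
  also have "\<dots> = (\<integral>\<^sup>+u. \<integral>\<^sup>+w. ennreal (1 / (cmod u)\<^sup>2) * J (u, w / u) * g w \<partial>lborel \<partial>lborel)"
  proof (rule nn_integral_cong_AE, rule AE_mp[OF AE_lborel_singleton[of 0]], rule AE_I2, rule impI)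
    fix u :: complex assume u: "u \<noteq> 0"
    have "ennreal (1 / (cmod u)\<^sup>2) * (ennreal ((cmod u)\<^sup>2) * x) = x" for x
      using u by (simp add: mult.assoc[symmetric] ennreal_mult[symmetric])
    then have "(\<integral>\<^sup>+v. J (u, v) * g (u * v) \<partial>lborel) =
        ennreal (1 / (cmod u)\<^sup>2) * (ennreal ((cmod u)\<^sup>2)
            * (\<integral>\<^sup>+v. J (u, (0 + u * v) / u) * g (0 + u * v) \<partial>lborel))"
      using u by simp
    also have "\<dots> = ennreal (1 / (cmod u)\<^sup>2) * (\<integral>\<^sup>+w. J (u, w / u) * g w \<partial>lborel)"
      using u by (subst (2) nn_integral_complex_affine[where m = 0 and c = u]) auto
    also have "\<dots> = (\<integral>\<^sup>+w. ennreal (1 / (cmod u)\<^sup>2) * J (u, w / u) * g w \<partial>lborel)"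
      by (subst nn_integral_cmult[symmetric]) (auto simp: mult.assoc)
    finally show "(\<integral>\<^sup>+v. J (u, v) * g (u * v) \<partial>lborel) =
      (\<integral>\<^sup>+w. ennreal (1 / (cmod u)\<^sup>2) * J (u, w / u) * g w \<partial>lborel)" .
  qed
  also have "\<dots> = (\<integral>\<^sup>+w. \<integral>\<^sup>+u. ennreal (1 / (cmod u)\<^sup>2) * J (u, w / u) * g w \<partial>lborel \<partial>lborel)"
    by (rule pair_sigma_finite.Fubini'[OF CC]) simp
  also have "\<dots> = (\<integral>\<^sup>+w. ?q w * g w \<partial>lborel)"
    unfolding q by (intro nn_integral_cong) (simp add: nn_integral_multc)
  finally show "(\<integral>\<^sup>+\<omega>. g (U \<omega> * V \<omega>) \<partial>M) = (\<integral>\<^sup>+w. ?q w * g w \<partial>lborel)" .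
qed

text \<open>Where the left-hand side is infinite, the iterated Bochner integral is only a conventional value;
finiteness makes almost every inner function and the outer one integrable.\<close>

lemma iterated_integral_eq_nn_integral:
  fixes k :: "real \<Rightarrow> real \<Rightarrow> real"
  assumes [measurable]: "case_prod k \<in> borel_measurable (borel \<Otimes>\<^sub>M borel)"
    and nonneg: "\<And>x y. 0 \<le> k x y"
    and fin: "(\<integral>\<^sup>+x. \<integral>\<^sup>+y. ennreal (k x y) \<partial>lborel \<partial>lborel) < \<infinity>"
  shows "(\<integral>\<^sup>+x. \<integral>\<^sup>+y. ennreal (k x y) \<partial>lborel \<partial>lborel) = ennreal (\<integral>x. \<integral>y. k x y \<partial>lborel \<partial>lborel)"
proof -
  have "AE x in lborel. (\<integral>\<^sup>+y. ennreal (k x y) \<partial>lborel) \<noteq> \<infinity>"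
    by (rule nn_integral_PInf_AE) (use fin in auto)
  then have ae: "AE x in lborel. (\<integral>\<^sup>+y. ennreal (k x y) \<partial>lborel) = ennreal (\<integral>y. k x y \<partial>lborel)"
  proof eventually_elim
    case (elim x)
    then have "integrable lborel (k x)"
      by (intro integrableI_nonneg) (auto simp: nonneg less_top)
    then show ?case by (rule nn_integral_eq_integral) (simp add: nonneg)
  qed
  then have *: "(\<integral>\<^sup>+x. \<integral>\<^sup>+y. ennreal (k x y) \<partial>lborel \<partial>lborel)
      = (\<integral>\<^sup>+x. ennreal (\<integral>y. k x y \<partial>lborel) \<partial>lborel)"
    by (rule nn_integral_cong_AE)
  then have "integrable lborel (\<lambda>x. \<integral>y. k x y \<partial>lborel)"
    using fin by (intro integrableI_nonneg) (auto simp: nonneg)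
  then show ?thesis
    unfolding * by (rule nn_integral_eq_integral) (simp add: nonneg)
qed

section \<open>Nondegenerate circular Gaussian pairs\<close>

locale hermitian_2x2 =
  fixes G :: "complex ^ 2 ^ 2" and p g D :: real and q :: complex
  assumes entries: "G $ 1 $ 1 = of_real p" "G $ 1 $ 2 = q" "G $ 2 $ 1 = cnj q" "G $ 2 $ 2 = of_real g"
    and D_def: "D = p * g - (cmod q)\<^sup>2"
begin

lemma hermitian_form_eq:
  "hermitian_form G b = of_real (p * (cmod (b $ 1))\<^sup>2 + 2 * Re (cnj (b $ 1) * q * b $ 2) + g
      * (cmod (b $ 2))\<^sup>2)"
  unfolding hermitian_form_def matrix_vector_mult_def
  by (simp add: sum_2 entries complex_eq_iff cmod_power2) (simp add: algebra_simps power2_eq_square)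

lemma det_eq: "det G = of_real D"
  by (simp add: det_2 entries D_def complex_norm_square del: of_real_power)

end

locale pos_def_2x2 = hermitian_2x2 +
  assumes p_pos: "0 < p" and D_pos: "0 < D"
begin

lemma g_pos: "0 < g"
proof -
  have "0 < p * g" using D_pos zero_le_power2[of "cmod q"] unfolding D_def by linarith
  then show ?thesis using p_pos by (simp add: zero_less_mult_iff)
qed

text \<open>The lower triangular Cholesky factor of \<open>G\<close>, with entries \<open>l11\<close>, \<open>l21\<close> and \<open>l22\<close>.\<close>

definition l11 :: real where "l11 = sqrt p"
definition l21 :: complex where "l21 = cnj q / of_real (sqrt p)"
definition l22 :: real where "l22 = sqrt (D / p)"

lemma l11_pos: "0 < l11" and l22_pos: "0 < l22"
  using p_pos D_pos by (simp_all add: l11_def l22_def)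

lemma l11_square: "l11\<^sup>2 = p" and l22_square: "l22\<^sup>2 = D / p"
  using p_pos D_pos by (simp_all add: l11_def l22_def)

lemma l11_mult: "complex_of_real l11 * of_real l11 = of_real p"
  by (metis l11_square of_real_mult power2_eq_square)

lemma l22_mult: "complex_of_real l22 * of_real l22 = of_real (D / p)"
  by (metis l22_square of_real_mult power2_eq_square)

text \<open>The vector \<open>(adj1 z\<^sub>1 z\<^sub>2, adj2 z\<^sub>2)\<close> is the preimage of \<open>z\<close> under the conjugate transpose of the
Cholesky factor \<open>L\<close>.  As \<open>G = L L\<^sup>*\<close>, the matrix \<open>G\<close> maps it to \<open>L z\<close>; this single identity
evaluates the Hermitian forms of both \<open>G\<close> and its inverse.\<close>

definition adj2 :: "complex \<Rightarrow> complex" where "adj2 z\<^sub>2 = z\<^sub>2 / of_real l22"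
definition adj1 :: "complex \<Rightarrow> complex \<Rightarrow> complex" where
  "adj1 z\<^sub>1 z\<^sub>2 = z\<^sub>1 / of_real l11 - q / of_real p * adj2 z\<^sub>2"

lemma cholesky_mult:
  "G *v vector [adj1 z\<^sub>1 z\<^sub>2, adj2 z\<^sub>2] = vector [of_real l11 * z\<^sub>1, l21 * z\<^sub>1 + of_real l22 * z\<^sub>2]"
proof -
  note aa = l11_mult and dd = l22_mult
  have nz: "complex_of_real l11 \<noteq> 0" "complex_of_real l22 \<noteq> 0" "complex_of_real p \<noteq> 0"
    using l11_pos l22_pos p_pos by auto
  have 1: "of_real p * adj1 z\<^sub>1 z\<^sub>2 + q * adj2 z\<^sub>2 = of_real l11 * z\<^sub>1"
    using nz aa by (simp add: adj1_def field_simps)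
  have "complex_of_real D = of_real p * of_real g - q * cnj q"
    by (simp add: D_def complex_norm_square del: of_real_power)
  then have D': "of_real g - cnj q * q / of_real p = complex_of_real l22 * of_real l22"
    unfolding dd using nz by (simp add: field_simps)
  have "cnj q * adj1 z\<^sub>1 z\<^sub>2 + of_real g * adj2 z\<^sub>2 = cnj q / of_real l11 * z\<^sub>1
      + (of_real g - cnj q * q / of_real p) * adj2 z\<^sub>2"
    by (simp add: adj1_def algebra_simps)
  also have "\<dots> = l21 * z\<^sub>1 + of_real l22 * z\<^sub>2"
    unfolding D' using nz by (simp add: l21_def adj2_def l11_def)
  finally have 2: "cnj q * adj1 z\<^sub>1 z\<^sub>2 + of_real g * adj2 z\<^sub>2 = l21 * z\<^sub>1 + of_real l22 * z\<^sub>2" .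
  show ?thesis
    using 1 2 by (simp add: vec_eq_iff forall_2 matrix_vector_mult_def sum_2 entries)
qed

lemma cholesky_inner:
  "cnj (of_real l11 * z\<^sub>1) * adj1 z\<^sub>1 z\<^sub>2 + cnj (l21 * z\<^sub>1 + of_real l22 * z\<^sub>2) * adj2 z\<^sub>2 =
     of_real ((cmod z\<^sub>1)\<^sup>2 + (cmod z\<^sub>2)\<^sup>2)"
proof -
  have nz: "complex_of_real l11 \<noteq> 0" "complex_of_real l22 \<noteq> 0" "complex_of_real p \<noteq> 0"
    using l11_pos l22_pos p_pos by auto
  note aa = l11_mult[symmetric]
  have l21: "cnj l21 = q / of_real l11" by (simp add: l21_def l11_def)
  have "cnj (of_real l11 * z\<^sub>1) * adj1 z\<^sub>1 z\<^sub>2 + cnj (l21 * z\<^sub>1 + of_real l22 * z\<^sub>2) * adj2 z\<^sub>2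
      = z\<^sub>1 * cnj z\<^sub>1 + z\<^sub>2 * cnj z\<^sub>2"
    using nz by (simp add: adj1_def adj2_def l21 aa field_simps)
  then show ?thesis by (simp add: complex_norm_square del: of_real_power)
qed

lemma hermitian_form_cholesky:
  "Re (hermitian_form G (vector [adj1 z\<^sub>1 z\<^sub>2, adj2 z\<^sub>2])) = (cmod z\<^sub>1)\<^sup>2 + (cmod z\<^sub>2)\<^sup>2"
proof -
  have "hermitian_form G (vector [adj1 z\<^sub>1 z\<^sub>2, adj2 z\<^sub>2]) =
      cnj (cnj (of_real l11 * z\<^sub>1) * adj1 z\<^sub>1 z\<^sub>2 + cnj (l21 * z\<^sub>1 + of_real l22 * z\<^sub>2) * adj2 z\<^sub>2)"
    unfolding hermitian_form_def cholesky_mult by (simp add: sum_2 mult.commute)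
  then show ?thesis unfolding cholesky_inner by simp
qed

lemma invertible: "invertible G"
  using D_pos by (simp add: invertible_det_nz det_eq)

lemma hermitian_form_inv_cholesky:
  "Re (hermitian_form (matrix_inv G) (vector [of_real l11 * z\<^sub>1, l21 * z\<^sub>1 + of_real l22 * z\<^sub>2]))
      = (cmod z\<^sub>1)\<^sup>2 + (cmod z\<^sub>2)\<^sup>2"
proof -
  have "matrix_inv G ** G = mat 1"
    using invertible unfolding invertible_def matrix_inv_def by (rule someI2_ex) simp
  then have "matrix_inv G *v (G *v v) = v" for v
    by (simp add: matrix_vector_mul_assoc)
  then have "matrix_inv G *v (vector [of_real l11 * z\<^sub>1, l21 * z\<^sub>1 + of_real l22 * z\<^sub>2])
      = vector [adj1 z\<^sub>1 z\<^sub>2, adj2 z\<^sub>2]"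
    unfolding cholesky_mult[symmetric] by simp
  then show ?thesis
    using cholesky_inner[of z\<^sub>1 z\<^sub>2] unfolding hermitian_form_def by (simp add: sum_2)
qed

end

definition complex_normal_pair_density :: "complex ^ 2 ^ 2 \<Rightarrow> complex ^ 2 \<Rightarrow> complex \<times> complex \<Rightarrow>
    real" where
  "complex_normal_pair_density G m z =
     1 / (pi\<^sup>2 * Re (det G)) * exp (- Re (hermitian_form (matrix_inv G) (vector
         [fst z - m $ 1, snd z - m $ 2])))"

lemma complex_normal_pair_density_measurable [measurable]:
  "complex_normal_pair_density G m \<in> borel_measurable (borel \<Otimes>\<^sub>M borel)"
  unfolding complex_normal_pair_density_def hermitian_form_def matrix_vector_mult_def
  by (simp add: sum_2)

text \<open>The characteristic function of a Gaussian vector \<open>Y - m\<close> that is circularly symmetric and has second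
moment matrix \<open>G\<close>: the real inner product with \<open>b\<close> is the real part of the Hermitian one, and its
variance is half of the Hermitian form.\<close>

locale circular_gaussian_pair = prob_space + pos_def_2x2 +
  fixes Y :: "'a \<Rightarrow> complex ^ 2" and m :: "complex ^ 2"
  assumes Y_measurable: "\<And>l. (\<lambda>\<omega>. Y \<omega> $ l) \<in> borel_measurable M"
    and char_Y: "\<And>b. (\<integral>\<omega>. iexp (b \<bullet> (Y \<omega> - m)) \<partial>M) = of_real (exp (- Re (hermitian_form G b) / 4))"
begin

text \<open>The standardised component has the characteristic function of the standard complex normal law, as
seen by testing \<open>Y - m\<close> with vectors supported on one coordinate.\<close>

lemma distributed_component:
  "distributed M lborel (\<lambda>\<omega>. Y \<omega> $ l) (\<lambda>w. ennreal (complex_normal_density (G $ l $ l) (m $ l) w))"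
proof -
  note Y_measurable[measurable]
  define v where "v = Re (G $ l $ l)"
  have v: "0 < v" "G $ l $ l = of_real v"
    using exhaust_2[of l] p_pos g_pos by (auto simp: v_def entries)
  then have sv: "(complex_of_real (sqrt v))\<^sup>2 = of_real v"
    by (metis less_imp_le of_real_power real_sqrt_pow2)
  define Z where "Z \<omega> = (Y \<omega> $ l - m $ l) / of_real (sqrt v)" for \<omega>
  have [measurable]: "Z \<in> borel_measurable M" unfolding Z_def by measurable
  have Y: "Y \<omega> $ l = m $ l + of_real (sqrt v) * Z \<omega>" for \<omega>
    using v by (simp add: Z_def)
  have "(\<integral>\<omega>. iexp (b \<bullet> Z \<omega>) \<partial>M) = of_real (exp (- (cmod b)\<^sup>2 / 4))" for b
  proof -
    let ?b = "axis l (b / of_real (sqrt v)) :: complex ^ 2"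
    have "b \<bullet> Z \<omega> = ?b \<bullet> (Y \<omega> - m)" for \<omega>
      by (simp add: inner_axis' Z_def inner_complex_def)
    moreover have "hermitian_form G ?b = of_real ((cmod b)\<^sup>2)"
      using exhaust_2[of l] v
      by (auto simp: hermitian_form_eq entries axis_def norm_divide power_divide sv)
    ultimately show ?thesis using char_Y[of ?b] by simp
  qed
  then have Z: "distr M borel Z = std_complex_normal"
    by (intro distr_eq_std_complex_normal) auto
  show ?thesis
  proof (rule distributedI_nn_integral)
    fix f :: "complex \<Rightarrow> ennreal" assume "f \<in> borel_measurable lborel"
    then have [measurable]: "f \<in> borel_measurable borel" by simp
    have [measurable]: "complex_normal_density (G $ l $ l) (m $ l) \<in> borel_measurable borel"
      unfolding complex_normal_density_def by measurable
    have "(\<integral>\<^sup>+\<omega>. f (Y \<omega> $ l) \<partial>M) = (\<integral>\<^sup>+z. f (m $ l + of_real (sqrt v) * z) \<partial>distr M borel Z)"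
      by (subst nn_integral_distr) (auto simp: Y)
    also have "\<dots> = (\<integral>\<^sup>+z. ennreal (exp (- (cmod z)\<^sup>2) / pi) * f (m $ l + of_real (sqrt v) * z) \<partial>lborel)"
      unfolding Z std_complex_normal_def by (subst nn_integral_density) auto
    also have "\<dots> = (\<integral>\<^sup>+z. ennreal v * (ennreal (complex_normal_density (G $ l $ l) (m $ l) (m $ l
        + of_real (sqrt v) * z)) * f (m $ l + of_real (sqrt v) * z)) \<partial>lborel)"
      using v by (intro nn_integral_cong)
        (simp add: complex_normal_density_def mult.assoc[symmetric] ennreal_mult'[symmetric]
            norm_mult power_mult_distrib)
    also have "\<dots> = ennreal v * (\<integral>\<^sup>+z. ennreal (complex_normal_density (G $ l $ l) (m $ l) (m $ l
        + of_real (sqrt v) * z)) * f (m $ l + of_real (sqrt v) * z) \<partial>lborel)"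
      by (rule nn_integral_cmult) simp
    also have "\<dots> = (\<integral>\<^sup>+w. ennreal (complex_normal_density (G $ l $ l) (m $ l) w) * f w \<partial>lborel)"
      using v(1) by (subst nn_integral_complex_affine[where m = "m $ l" and c = "of_real (sqrt v)" and
          f = "\<lambda>w. ennreal (complex_normal_density (G $ l $ l) (m $ l) w) * f w"]) auto
    finally show "(\<integral>\<^sup>+\<omega>. f (Y \<omega> $ l) \<partial>M) = (\<integral>\<^sup>+w. ennreal
        (complex_normal_density (G $ l $ l) (m $ l) w) * f w \<partial>lborel)" .
  qed (simp_all add: complex_normal_density_def)
qed

text \<open>The Cholesky factor expresses \<open>Y - m\<close> by a pair \<open>(Z1, Z2)\<close> of independent standard complex normal
variables.  The two affine substitutions contribute \<open>l11\<^sup>2 * l22\<^sup>2\<close>, which is the determinant.\<close>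

lemma distributed_pair:
  "distributed M (lborel \<Otimes>\<^sub>M lborel) (\<lambda>\<omega>. (Y \<omega> $ 1, Y \<omega> $ 2))
      (\<lambda>z. ennreal (complex_normal_pair_density G m z))"
proof -
  note Y_measurable[measurable]
  define Z1 where "Z1 \<omega> = (Y \<omega> $ 1 - m $ 1) / of_real l11" for \<omega>
  define Z2 where "Z2 \<omega> = (Y \<omega> $ 2 - m $ 2 - l21 * Z1 \<omega>) / of_real l22" for \<omega>
  have [measurable]: "Z1 \<in> borel_measurable M" unfolding Z1_def by measurable
  have [measurable]: "Z2 \<in> borel_measurable M" unfolding Z2_def by measurable
  have Y1: "Y \<omega> $ 1 = m $ 1 + of_real l11 * Z1 \<omega>" for \<omega>
    using l11_pos by (simp add: Z1_def)
  have Y2: "Y \<omega> $ 2 = m $ 2 + l21 * Z1 \<omega> + of_real l22 * Z2 \<omega>" for \<omega>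
    using l22_pos by (simp add: Z2_def)
  have "(\<integral>\<omega>. iexp (b\<^sub>1 \<bullet> Z1 \<omega> + b\<^sub>2 \<bullet> Z2 \<omega>) \<partial>M)
      = of_real (exp (- ((cmod b\<^sub>1)\<^sup>2 + (cmod b\<^sub>2)\<^sup>2) / 4))" for b\<^sub>1 b\<^sub>2
  proof -
    let ?b = "vector [adj1 b\<^sub>1 b\<^sub>2, adj2 b\<^sub>2] :: complex ^ 2"
    have nz: "complex_of_real l11 \<noteq> 0" "complex_of_real l22 \<noteq> 0" "complex_of_real p \<noteq> 0"
      using l11_pos l22_pos p_pos by auto
    note aa = l11_mult[symmetric]
    have "b\<^sub>1 \<bullet> Z1 \<omega> + b\<^sub>2 \<bullet> Z2 \<omega> = ?b \<bullet> (Y \<omega> - m)" for \<omega>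
    proof -
      have inner: "x \<bullet> y = Re (cnj x * y)" for x y :: complex by (simp add: inner_complex_def)
      have "cnj (adj1 b\<^sub>1 b\<^sub>2) * (of_real l11 * Z1 \<omega>) + cnj (adj2 b\<^sub>2)
          * (l21 * Z1 \<omega> + of_real l22 * Z2 \<omega>) =
          cnj b\<^sub>1 * Z1 \<omega> + cnj b\<^sub>2 * Z2 \<omega>"
        using nz by (simp add: adj1_def adj2_def l21_def l11_def[symmetric] aa field_simps)
      then have "Re (cnj (adj1 b\<^sub>1 b\<^sub>2) * (of_real l11 * Z1 \<omega>))
          + Re (cnj (adj2 b\<^sub>2) * (l21 * Z1 \<omega> + of_real l22 * Z2 \<omega>)) =
          Re (cnj b\<^sub>1 * Z1 \<omega>) + Re (cnj b\<^sub>2 * Z2 \<omega>)"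
        by (metis plus_complex.sel(1))
      then show ?thesis
        unfolding inner_vec_def inner by (simp add: sum_2 Y1 Y2 del: times_complex.sel complex_cnj_mult)
    qed
    then show ?thesis using char_Y[of ?b] by (simp add: hermitian_form_cholesky)
  qed
  then have Z: "distr M (borel \<Otimes>\<^sub>M borel) (\<lambda>\<omega>. (Z1 \<omega>, Z2 \<omega>)) = std_complex_normal \<Otimes>\<^sub>M std_complex_normal"
    by (intro distr_pair_eq_std_complex_normal) auto
  interpret S: prob_space std_complex_normal by (rule prob_space_std_complex_normal)
  have [measurable_cong]: "sets std_complex_normal = sets borel" by (simp add: std_complex_normal_def)
  let ?J = "\<lambda>z. ennreal (complex_normal_pair_density G m z)"
  let ?w1 = "\<lambda>z1. m $ 1 + of_real l11 * z1" and ?w2 = "\<lambda>z1 z2. m $ 2 + l21 * z1 + of_real l22 * z2"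
  have J: "ennreal (exp (- (cmod z1)\<^sup>2) / pi) * ennreal (exp (- (cmod z2)\<^sup>2) / pi) =
      ennreal (l11\<^sup>2) * ennreal (l22\<^sup>2) * ?J (?w1 z1, ?w2 z1 z2)" for z1 z2
  proof -
    have e: "- Re (hermitian_form (matrix_inv G) (vector [?w1 z1 - m $ 1, ?w2 z1 z2 - m $ 2]))
        = - (cmod z1)\<^sup>2 + - (cmod z2)\<^sup>2"
      using hermitian_form_inv_cholesky[of z1 z2] by (simp add: add.assoc)
    have "l11\<^sup>2 * l22\<^sup>2 = D" using p_pos by (simp add: l11_square l22_square)
    then have "exp (- (cmod z1)\<^sup>2) / pi * (exp (- (cmod z2)\<^sup>2) / pi) =
        l11\<^sup>2 * l22\<^sup>2 * complex_normal_pair_density G m (?w1 z1, ?w2 z1 z2)"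
      using D_pos unfolding complex_normal_pair_density_def fst_conv snd_conv e exp_add
      by (simp add: det_eq power2_eq_square)
    then show ?thesis by (simp add: ennreal_mult'[symmetric] del: ennreal_mult'')
  qed
  show ?thesis
  proof (rule distributedI_nn_integral)
    show "(\<lambda>\<omega>. (Y \<omega> $ 1, Y \<omega> $ 2)) \<in> M \<rightarrow>\<^sub>M lborel \<Otimes>\<^sub>M lborel"
      by (simp add: measurable_Pair)
    show "?J \<in> borel_measurable (lborel \<Otimes>\<^sub>M lborel)" by measurable
    fix f :: "complex \<times> complex \<Rightarrow> ennreal" assume "f \<in> borel_measurable (lborel \<Otimes>\<^sub>M lborel)"
    then have [measurable]: "f \<in> borel_measurable (borel \<Otimes>\<^sub>M borel)" by (simp cong: measurable_cong_sets)
    have "(\<integral>\<^sup>+\<omega>. f (Y \<omega> $ 1, Y \<omega> $ 2) \<partial>M) =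
        (\<integral>\<^sup>+z. f (?w1 (fst z), ?w2 (fst z) (snd z)) \<partial>distr M (borel \<Otimes>\<^sub>M borel) (\<lambda>\<omega>. (Z1 \<omega>, Z2 \<omega>)))"
      by (subst nn_integral_distr) (auto simp: Y1 Y2)
    also have "\<dots> = (\<integral>\<^sup>+z1. \<integral>\<^sup>+z2. f (?w1 z1, ?w2 z1 z2) \<partial>std_complex_normal \<partial>std_complex_normal)"
      unfolding Z by (subst S.nn_integral_fst[symmetric]) auto
    also have "\<dots> = (\<integral>\<^sup>+z1. ennreal (exp (- (cmod z1)\<^sup>2) / pi)
        * (\<integral>\<^sup>+z2. ennreal (exp (- (cmod z2)\<^sup>2) / pi) * f (?w1 z1, ?w2 z1 z2) \<partial>lborel) \<partial>lborel)"
      unfolding std_complex_normal_def by (subst nn_integral_density; simp add: nn_integral_density)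
    also have "\<dots> = (\<integral>\<^sup>+z1. ennreal (l11\<^sup>2) * (ennreal (l22\<^sup>2)
        * (\<integral>\<^sup>+z2. ?J (?w1 z1, ?w2 z1 z2) * f (?w1 z1, ?w2 z1 z2) \<partial>lborel)) \<partial>lborel)"
      by (simp add: nn_integral_cmult[symmetric] mult.assoc[symmetric] J)
    also have "\<dots> = (\<integral>\<^sup>+z1. ennreal (l11\<^sup>2) * (\<integral>\<^sup>+w. ?J (?w1 z1, w) * f (?w1 z1, w) \<partial>lborel) \<partial>lborel)"
    proof (intro nn_integral_cong arg_cong2[where f = "(*)"] refl)
      fix z1
      show "ennreal (l22\<^sup>2) * (\<integral>\<^sup>+z2. ?J (?w1 z1, ?w2 z1 z2) * f (?w1 z1, ?w2 z1 z2) \<partial>lborel) =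
          (\<integral>\<^sup>+w. ?J (?w1 z1, w) * f (?w1 z1, w) \<partial>lborel)"
        using l22_pos by (subst (2) nn_integral_complex_affine[where m = "m $ 2 + l21 * z1" and c
            = "of_real l22"]) auto
    qed
    also have "\<dots> = (\<integral>\<^sup>+w1. \<integral>\<^sup>+w. ?J (w1, w) * f (w1, w) \<partial>lborel \<partial>lborel)"
      using l11_pos by (subst nn_integral_cmult, simp,
          subst (2) nn_integral_complex_affine[where m = "m $ 1" and c = "of_real l11"]) auto
    also have "\<dots> = (\<integral>\<^sup>+z. ?J z * f z \<partial>(lborel \<Otimes>\<^sub>M lborel))"
      by (subst lborel.nn_integral_fst[symmetric]) auto
    finally show "(\<integral>\<^sup>+\<omega>. f (Y \<omega> $ 1, Y \<omega> $ 2) \<partial>M) = (\<integral>\<^sup>+z. ?J z * f z \<partial>(lborel \<Otimes>\<^sub>M lborel))" .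
  qed
qed

text \<open>The density of the product is first obtained in the extended nonnegative reals.  Its integral is
one, so it is finite almost everywhere, and there it agrees with the iterated integral that defines
\<open>normal_product_density\<close>.\<close>

lemma distributed_product:
  "distributed M lborel (\<lambda>\<omega>. Y \<omega> $ 1 * Y \<omega> $ 2) (\<lambda>w. ennreal (normal_product_density G m w))"
proof -
  let ?J = "complex_normal_pair_density G m"
  define k where "k w r \<theta> = indicator {0<..} r * (indicator {0..2*pi} \<theta> *
     (1 / r * ?J (of_real r * exp (\<i> * of_real \<theta>), w * of_real (inverse r)
         * exp (- (\<i> * of_real \<theta>)))))" for w and r \<theta> :: real
  define q' where "q' w = (\<integral>\<^sup>+r. \<integral>\<^sup>+\<theta>. ennreal (k w r \<theta>) \<partial>lborel \<partial>lborel)" for w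
  have J0: "0 \<le> ?J z" for z using D_pos by (simp add: complex_normal_pair_density_def det_eq)
  have k0: "0 \<le> k w r \<theta>" for w r \<theta> by (auto simp: k_def J0 indicator_def)
  have [measurable (raw)]: "(\<lambda>x. k (w x) (r x) (\<theta> x)) \<in> borel_measurable N"
    if [measurable]: "w \<in> borel_measurable N" "r \<in> borel_measurable N" "\<theta> \<in> borel_measurable N"
    for w and r \<theta> :: "_ \<Rightarrow> real" and N :: "'x measure"
    unfolding k_def by measurable
  have km: "case_prod (k w) \<in> borel_measurable (borel \<Otimes>\<^sub>M borel)" for w
    unfolding k_def by measurable
  have dens: "normal_product_density G m w = (\<integral>r. \<integral>\<theta>. k w r \<theta> \<partial>lborel \<partial>lborel)" for w
    unfolding normal_product_density_def set_lebesgue_integral_def k_def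
        complex_normal_pair_density_def Let_def
    by (simp add: mult_ac)
  have dens_meas: "(\<lambda>w. normal_product_density G m w) \<in> borel_measurable borel"
    unfolding dens by measurable
  have "(\<integral>\<^sup>+r\<in>{0<..}. (\<integral>\<^sup>+\<theta>\<in>{0..2 * pi}.
     ennreal (1 / r) * ennreal (?J (of_real r * exp (\<i> * of_real \<theta>), w * of_real (inverse r)
         * exp (- (\<i> * of_real \<theta>)))) \<partial>lborel) \<partial>lborel) = q' w" for w
    unfolding q'_def k_def
    by (intro nn_integral_cong) (auto simp: indicator_def J0 ennreal_mult'[symmetric] intro!:
        nn_integral_cong)
  then have q': "distributed M lborel (\<lambda>\<omega>. Y \<omega> $ 1 * Y \<omega> $ 2) q'"
    using distributed_complex_product[OF distributed_pair] by simp
  have "(\<integral>\<^sup>+w. q' w \<partial>lborel) = 1"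
    using distributed_nn_integral[OF q', of "\<lambda>_. 1"] by (simp add: emeasure_space_1)
  then have "AE w in lborel. q' w \<noteq> \<infinity>"
    using distributed_borel_measurable[OF q'] by (intro nn_integral_PInf_AE) auto
  then have ae: "AE w in lborel. q' w = ennreal (normal_product_density G m w)"
  proof eventually_elim
    case (elim w)
    show ?case
      using iterated_integral_eq_nn_integral[OF km k0, of w] elim unfolding dens q'_def
          by (simp add: less_top)
  qed
  show ?thesis
    unfolding distributed_def
  proof (intro conjI)
    have "density lborel q' = density lborel (\<lambda>w. ennreal (normal_product_density G m w))"
      using distributed_borel_measurable[OF q'] dens_meas ae by (intro density_cong) auto
    then show "distr M lborel (\<lambda>\<omega>. Y \<omega> $ 1 * Y \<omega> $ 2)
        = density lborel (\<lambda>w. ennreal (normal_product_density G m w))"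
      using distributed_distr_eq_density[OF q'] by simp
    show "random_variable lborel (\<lambda>\<omega>. Y \<omega> $ 1 * Y \<omega> $ 2)"
      using distributed_measurable[OF q'] .
  qed (use dens_meas in simp)
qed

end

section \<open>Wavelet transforms of Gaussian processes\<close>

lemma analytic_weight_sum:
  assumes h: "\<And>i. i \<in> I \<Longrightarrow> analytic_weight (h i)"
  shows "analytic_weight (\<lambda>\<tau>. \<Sum>i\<in>I. c i * h i \<tau>)"
proof -
  have hi: "integrable lborel (h i)" if "i \<in> I" for i using h[OF that] by (simp add: analytic_weight_def)
  have he: "integrable lborel (\<lambda>\<tau>. h i \<tau> * iexp (l * \<tau>))" if "i \<in> I" for i l
  proof (rule Bochner_Integration.integrable_bound[OF hi[OF that]])
    have [measurable]: "h i \<in> borel_measurable borel" using hi[OF that] by auto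
    show "(\<lambda>\<tau>. h i \<tau> * iexp (l * \<tau>)) \<in> borel_measurable lborel" by measurable
  qed (simp add: norm_mult)
  have "(\<integral>\<tau>. (\<Sum>i\<in>I. c i * h i \<tau>) * iexp (l * \<tau>) \<partial>lborel) = 0" if "l \<le> 0" for l
  proof -
    have "(\<integral>\<tau>. (\<Sum>i\<in>I. c i * h i \<tau>) * iexp (l * \<tau>) \<partial>lborel) =
        (\<integral>\<tau>. (\<Sum>i\<in>I. c i * (h i \<tau> * iexp (l * \<tau>))) \<partial>lborel)"
      by (simp only: sum_distrib_right mult.assoc)
    also have "\<dots> = (\<Sum>i\<in>I. c i * (\<integral>\<tau>. h i \<tau> * iexp (l * \<tau>) \<partial>lborel))"
      by (subst Bochner_Integration.integral_sum)
          (auto intro!: integrable_mult_right he simp del: of_real_mult)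
    also have "\<dots> = 0"
      using h that by (simp add: analytic_weight_def del: of_real_mult)
    finally show ?thesis .
  qed
  moreover have "integrable lborel (\<lambda>\<tau>. \<Sum>i\<in>I. c i * h i \<tau>)"
    using hi by (intro Bochner_Integration.integrable_sum integrable_mult_right) auto
  ultimately show ?thesis by (simp add: analytic_weight_def del: of_real_mult)
qed

text \<open>The substitution \<open>\<tau> = t + s * x\<close> expresses the transform at \<open>l\<close> by the conjugate of \<open>fourier \<psi>\<close>
at \<open>l * s\<close>, and \<open>s > 0\<close> keeps the sign of the frequency.\<close>

lemma analytic_weight_wavelet:
  assumes \<psi>: "analytic_mother_wavelet \<psi>" and s: "0 < s"
  shows "analytic_weight (\<lambda>\<tau>. of_real (1 / sqrt s) * cnj (\<psi> ((\<tau> - t) / s)))"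
proof -
  have i: "integrable lborel \<psi>" and z: "\<And>\<omega>. \<omega> \<le> 0 \<Longrightarrow> fourier \<psi> \<omega> = 0"
    using \<psi> by (auto simp: analytic_mother_wavelet_def)
  have e: "- t / s + 1 / s * \<tau> = (\<tau> - t) / s" for \<tau>
    by (simp add: diff_divide_distrib)
  have "integrable lborel (\<lambda>\<tau>. \<psi> ((\<tau> - t) / s))"
    using lborel_integrable_real_affine[OF i, of "1 / s" "- t / s"] s unfolding e by simp
  then have int: "integrable lborel (\<lambda>\<tau>. of_real (1 / sqrt s) * cnj (\<psi> ((\<tau> - t) / s)))"
    by (intro integrable_mult_right) simp
  have "(\<integral>\<tau>. of_real (1 / sqrt s) * cnj (\<psi> ((\<tau> - t) / s)) * iexp (l * \<tau>) \<partial>lborel) = 0" if l: "l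
      \<le> 0" for l
  proof -
    have "(\<integral>\<tau>. of_real (1 / sqrt s) * cnj (\<psi> ((\<tau> - t) / s)) * iexp (l * \<tau>) \<partial>lborel) =
      \<bar>s\<bar> *\<^sub>R (\<integral>x. of_real (1 / sqrt s) * cnj (\<psi> ((t + s * x - t) / s))
          * iexp (l * (t + s * x)) \<partial>lborel)"
      by (rule lborel_integral_real_affine) (use s in simp)
    also have "(\<integral>x. of_real (1 / sqrt s) * cnj (\<psi> ((t + s * x - t) / s))
        * iexp (l * (t + s * x)) \<partial>lborel)
      = (\<integral>x. of_real (1 / sqrt s) * iexp (l * t)
          * cnj (exp (- (\<i> * of_real x * of_real (l * s))) * \<psi> x) \<partial>lborel)"
    proof (rule Bochner_Integration.integral_cong[OF refl])
      fix x
      have "iexp (l * (t + s * x)) = iexp (l * t) * cnj (exp (- (\<i> * of_real x * of_real (l * s))))"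
        by (simp add: exp_cnj exp_add[symmetric] algebra_simps)
      then show "of_real (1 / sqrt s) * cnj (\<psi> ((t + s * x - t) / s)) * iexp (l * (t + s * x)) =
          of_real (1 / sqrt s) * iexp (l * t) * cnj (exp (- (\<i> * of_real x * of_real (l * s))) * \<psi> x)"
        using s by simp
    qed
    also have "\<dots> = of_real (1 / sqrt s) * iexp (l * t) * cnj (fourier \<psi> (l * s))"
      unfolding fourier_def by (simp only: integral_mult_right_zero Bochner_Integration.integral_cnj)
    also have "fourier \<psi> (l * s) = 0"
      using l s by (intro z) (simp add: mult_nonpos_nonneg)
    finally show ?thesis by simp
  qed
  with int show ?thesis by (simp add: analytic_weight_def del: of_real_mult)
qed

text \<open>In particular the second moment matrix is positive semidefinite.\<close>

lemma hermitian_form_second_moment_matrix: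
  assumes int: "\<And>i j. integrable M (\<lambda>\<omega>. W \<omega> $ i * cnj (W \<omega> $ j))"
  shows "hermitian_form (second_moment_matrix M W) b =
     of_real (\<integral>\<omega>. (cmod (\<Sum>i\<in>UNIV. cnj (b $ i) * W \<omega> $ i))\<^sup>2 \<partial>M)"
proof -
  have "complex_of_real ((cmod (\<Sum>i\<in>UNIV. cnj (b $ i) * W \<omega> $ i))\<^sup>2) =
      (\<Sum>i\<in>UNIV. \<Sum>j\<in>UNIV. cnj (b $ i) * b $ j * (W \<omega> $ i * cnj (W \<omega> $ j)))" for \<omega>
    unfolding complex_norm_square cnj_sum sum_product by (simp add: mult_ac)
  then have "complex_of_real (\<integral>\<omega>. (cmod (\<Sum>i\<in>UNIV. cnj (b $ i) * W \<omega> $ i))\<^sup>2 \<partial>M) =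
     (\<integral>\<omega>. (\<Sum>i\<in>UNIV. \<Sum>j\<in>UNIV. cnj (b $ i) * b $ j * (W \<omega> $ i * cnj (W \<omega> $ j))) \<partial>M)"
    by (simp only: integral_complex_of_real[symmetric])
  also have "\<dots> = (\<Sum>i\<in>UNIV. \<Sum>j\<in>UNIV. cnj (b $ i) * b $ j * (\<integral>\<omega>. W \<omega> $ i * cnj (W \<omega> $ j) \<partial>M))"
    by (simp add: Bochner_Integration.integral_sum int)
  also have "\<dots> = hermitian_form (second_moment_matrix M W) b"
    unfolding hermitian_form_def second_moment_matrix_def matrix_vector_mult_def
    by (simp add: sum_distrib_left mult_ac)
  finally show ?thesis ..
qed

text \<open>If \<open>p = 0\<close>, the form is affine along the line of vectors \<open>(r * q, 1)\<close>, and nonnegativity forces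
\<open>q = 0\<close>, hence \<open>D = 0\<close>.  Otherwise the minimum over the first coordinate at second coordinate one is
\<open>D / p\<close>, attained at \<open>- q / p\<close>.\<close>

lemma (in hermitian_2x2) pos_def_if_invertible:
  assumes nonneg: "\<And>b. 0 \<le> Re (hermitian_form G b)" and inv: "invertible G"
  shows "pos_def_2x2 G p g D q"
proof
  have D0: "D \<noteq> 0" using inv by (simp add: invertible_det_nz det_eq)
  have N: "0 \<le> p * (cmod x)\<^sup>2 + 2 * Re (cnj x * q * y) + g * (cmod y)\<^sup>2" for x y
    using nonneg[of "vector [x, y]"] unfolding hermitian_form_eq Re_complex_of_real vector_2 .
  have qq: "Re (cnj (of_real r * q) * q) = r * (cmod q)\<^sup>2" for r
  proof -
    have "cnj (of_real r * q) * q = of_real (r * (cmod q)\<^sup>2)"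
      by (simp add: complex_norm_square mult_ac del: of_real_power)
    then show ?thesis by (simp only: Re_complex_of_real)
  qed
  have p0: "0 \<le> p" using N[of 1 0] by simp
  have "p \<noteq> 0"
  proof
    assume p: "p = 0"
    \<comment> \<open>chosen so that the form at \<open>(- n * q, 1)\<close> equals \<open>g - \<bar>g\<bar> - 1\<close>\<close>
    define n where "n = (\<bar>g\<bar> + 1) / (2 * (cmod q)\<^sup>2)"
    have "q \<noteq> 0" using D0 by (auto simp: D_def p)
    then have "2 * (n * (cmod q)\<^sup>2) = \<bar>g\<bar> + 1" by (simp add: n_def)
    moreover have "0 \<le> 2 * (- n * (cmod q)\<^sup>2) + g"
      using N[of "of_real (- n) * q" 1] unfolding mult_1_right qq p by simp
    ultimately show False by simp
  qed
  with p0 show p: "0 < p" by simp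
  have "0 \<le> p * (cmod (of_real (- 1 / p) * q))\<^sup>2 + 2 * (- 1 / p * (cmod q)\<^sup>2) + g"
    using N[of "of_real (- 1 / p) * q" 1] unfolding mult_1_right qq by simp
  also have "\<dots> = D / p"
    using p by (simp add: D_def norm_mult norm_divide power_mult_distrib power_divide field_simps
        power2_eq_square)
  finally show "0 < D" using p D0 by (simp add: zero_le_divide_iff)
qed

text \<open>Only almost sure equality holds: a path for which one of the integrals diverges may break additivity,
since a divergent integral has the value zero.\<close>

lemma (in second_order_process) process_integral_sum:
  assumes I: "finite I" and h: "\<And>i. i \<in> I \<Longrightarrow> integrable lborel (h i)"
  shows "AE \<omega> in M. process_integral X (\<lambda>\<tau>. \<Sum>i\<in>I. c i * h i \<tau>) \<omega>
      = (\<Sum>i\<in>I. c i * process_integral X (h i) \<omega>)"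
proof -
  have "AE \<omega> in M. \<forall>i\<in>I. integrable lborel (\<lambda>\<tau>. h i \<tau> * of_real (X \<tau> \<omega>))"
    using pathwise_integrable[OF h] by (intro AE_finite_allI[OF I])
  then show ?thesis
  proof eventually_elim
    case (elim \<omega>)
    then show ?case
      by (simp add: process_integral_def sum_distrib_right mult.assoc Bochner_Integration.integral_sum)
  qed
qed

text \<open>A real linear functional of the vector is the real part of one path integral, whose weight is again
analytic.\<close>

lemma (in stationary_gaussian) expectation_iexp_analytic_vec:
  fixes h :: "'n::finite \<Rightarrow> real \<Rightarrow> complex"
  assumes h: "\<And>l. analytic_weight (h l)"
  defines "W \<equiv> \<lambda>\<omega>. \<chi> l. process_integral X (h l) \<omega>"
  shows "(\<integral>\<omega>. iexp (b \<bullet> W \<omega>) \<partial>M) = of_real (exp (-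
      Re (hermitian_form (second_moment_matrix M W) b) / 4))"
    and "0 \<le> Re (hermitian_form (second_moment_matrix M W) b)"
proof -
  have hi: "integrable lborel (h l)" for l using h by (simp add: analytic_weight_def)
  have [measurable]: "h l \<in> borel_measurable borel" for l using hi[of l] by auto
  let ?H = "\<lambda>\<tau>. \<Sum>l\<in>UNIV. cnj (b $ l) * h l \<tau>"
  let ?Z = "process_integral X ?H"
  have ae: "AE \<omega> in M. ?Z \<omega> = (\<Sum>l\<in>UNIV. cnj (b $ l) * W \<omega> $ l)"
    using process_integral_sum[of UNIV h "\<lambda>l. cnj (b $ l)"] hi by (simp add: W_def)
  have H: "analytic_weight ?H" by (rule analytic_weight_sum) (rule h)
  have [measurable]: "(\<lambda>\<omega>. W \<omega> $ l) \<in> borel_measurable M" for l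
    by (simp add: W_def)
  have [measurable]: "cnj \<in> borel_measurable borel"
    by (intro borel_measurable_continuous_onI continuous_intros)
  have "integrable M (\<lambda>\<omega>. W \<omega> $ i * cnj (W \<omega> $ j))" for i j
    by (rule Bochner_Integration.integrable_bound[OF integrable_process_integral_mult[OF hi[of i]
        hi[of j]]])
       (auto simp: norm_mult W_def)
  note hf = hermitian_form_second_moment_matrix[of M W b, OF this]
  have "expectation (\<lambda>\<omega>. (cmod (?Z \<omega>))\<^sup>2) = (\<integral>\<omega>. (cmod (\<Sum>i\<in>UNIV. cnj (b $ i) * W \<omega> $ i))\<^sup>2 \<partial>M)"
    by (rule integral_cong_AE) (use ae in \<open>auto elim!: eventually_mono\<close>)
  then have v: "Re (hermitian_form (second_moment_matrix M W) b) = expectation (\<lambda>\<omega>. (cmod (?Z \<omega>))\<^sup>2)"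
    unfolding hf by simp
  show "0 \<le> Re (hermitian_form (second_moment_matrix M W) b)" unfolding v by simp
  have inner: "x \<bullet> y = Re (cnj x * y)" for x y :: complex by (simp add: inner_complex_def)
  have "(\<integral>\<omega>. iexp (b \<bullet> W \<omega>) \<partial>M) = (\<integral>\<omega>. iexp (Re (?Z \<omega>)) \<partial>M)"
  proof (rule integral_cong_AE)
    show "AE \<omega> in M. iexp (b \<bullet> W \<omega>) = iexp (Re (?Z \<omega>))"
      using ae by eventually_elim (simp only: inner_vec_def inner Re_sum)
    show "(\<lambda>\<omega>. iexp (b \<bullet> W \<omega>)) \<in> borel_measurable M" unfolding inner_vec_def by measurable
  qed measurable
  also have "\<dots> = of_real (exp (- expectation (\<lambda>\<omega>. (cmod (?Z \<omega>))\<^sup>2) / 4))"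
    by (rule expectation_iexp_analytic[OF H])
  finally show "(\<integral>\<omega>. iexp (b \<bullet> W \<omega>) \<partial>M) = of_real
      (exp (- Re (hermitian_form (second_moment_matrix M W) b) / 4))"
    unfolding v .
qed

lemma (in prob_space) covariance_eq_expectation_diff:
  assumes f: "integrable M f" and g: "integrable M g" and fg: "integrable M (\<lambda>\<omega>. f \<omega> * g \<omega>)"
  shows "covariance M f g = expectation (\<lambda>\<omega>. f \<omega> * g \<omega>) - expectation f * expectation g"
proof -
  have "covariance M f g = expectation (\<lambda>\<omega>. f \<omega> * g \<omega> - expectation g * f \<omega> - expectation f * g \<omega>
      + expectation f * expectation g)"
    unfolding covariance_def by (rule Bochner_Integration.integral_cong) (auto simp: algebra_simps)
  also have "\<dots> = expectation (\<lambda>\<omega>. f \<omega> * g \<omega>) - expectation f * expectation g"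
    using f g fg by (simp add: prob_space)
  finally show ?thesis .
qed

lemma normal_product_density_nonneg:
  assumes "0 \<le> Re (det G)"
  shows "0 \<le> normal_product_density G m w"
  unfolding normal_product_density_def set_lebesgue_integral_def Let_def
  using assms by (intro integral_nonneg_AE AE_I2) (auto simp: indicator_def intro!: integral_nonneg_AE)

theorem proposition7:
  fixes M :: "'a measure" and \<psi> :: "real \<Rightarrow> complex" and f :: "real \<Rightarrow> real"
    and \<Phi> :: "real \<Rightarrow> 'a \<Rightarrow> real" and C :: "real \<Rightarrow> real" and F :: "real measure"
    and t s :: "real ^ 2"
    and W\<^sub>f :: "complex ^ 2" and W\<^sub>\<Phi> W\<^sub>Y :: "'a \<Rightarrow> complex ^ 2"
    and \<Gamma> :: "complex ^ 2 ^ 2"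
  assumes "prob_space M"
    and "analytic_mother_wavelet \<psi>"
    and "f \<in> borel_measurable borel" and "bounded (range f)"
    and "stationary_gaussian_process M \<Phi> C" and "spectral_measure F C"
    and "\<forall>l. s $ l > 0"
    and "W\<^sub>f = (\<chi> l. wavelet_transform \<psi> f (t $ l) (s $ l))"
    and "W\<^sub>\<Phi> = (\<lambda>\<omega>. \<chi> l. wavelet_transform \<psi> (\<lambda>\<tau>. \<Phi> \<tau> \<omega>) (t $ l) (s $ l))"
    and "W\<^sub>Y = (\<lambda>\<omega>. \<chi> l. wavelet_transform \<psi> (\<lambda>\<tau>. f \<tau> + \<Phi> \<tau> \<omega>) (t $ l) (s $ l))"
    and "\<Gamma> = second_moment_matrix M W\<^sub>\<Phi>" and "invertible \<Gamma>"
  shows "distributed M lborel (\<lambda>\<omega>. W\<^sub>Y \<omega> $ 1 * W\<^sub>Y \<omega> $ 2)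
           (\<lambda>w. ennreal (normal_product_density \<Gamma> W\<^sub>f w)) \<and>
         (\<forall>l. distributed M lborel (\<lambda>\<omega>. W\<^sub>Y \<omega> $ l)
           (\<lambda>w. ennreal (complex_normal_density (\<Gamma> $ l $ l) (W\<^sub>f $ l) w))) \<and>
         integrable lborel (\<lambda>w. cmod w * normal_product_density \<Gamma> W\<^sub>f w) \<and>
         (\<forall>l. integrable lborel
           (\<lambda>w. cmod w * complex_normal_density (\<Gamma> $ l $ l) (W\<^sub>f $ l) w)) \<and>
         covariance M (\<lambda>\<omega>. cmod (W\<^sub>Y \<omega> $ 1)) (\<lambda>\<omega>. cmod (W\<^sub>Y \<omega> $ 2)) =
           (\<integral>w. cmod w * normal_product_density \<Gamma> W\<^sub>f w \<partial>lborel) -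
           (\<Prod>l\<in>UNIV. \<integral>w. cmod w * complex_normal_density (\<Gamma> $ l $ l) (W\<^sub>f $ l) w \<partial>lborel)"
proof -
  interpret stationary_gaussian M \<Phi> C F
    using assms by (simp add: stationary_gaussian_def stationary_gaussian_axioms_def)
  define h where "h l \<tau> = of_real (1 / sqrt (s $ l)) * cnj (\<psi> ((\<tau> - t $ l) / s $ l))" for l \<tau>
  have h: "analytic_weight (h l)" for l
    unfolding h_def[abs_def] using assms by (intro analytic_weight_wavelet) auto
  have hi: "integrable lborel (h l)" for l using h by (simp add: analytic_weight_def)
  have [measurable]: "h l \<in> borel_measurable borel" for l using hi[of l] by auto
  note [measurable] = assms(3)
  have W: "wavelet_transform \<psi> g (t $ l) (s $ l) = (\<integral>\<tau>. h l \<tau> * of_real (g \<tau>) \<partial>lborel)" for g l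
    by (simp add: wavelet_transform_def h_def mult_ac)
  have W\<Phi>: "W\<^sub>\<Phi> = (\<lambda>\<omega>. \<chi> l. process_integral \<Phi> (h l) \<omega>)"
    by (simp add: assms W process_integral_def)
  have char\<Phi>: "(\<integral>\<omega>. iexp (b \<bullet> W\<^sub>\<Phi> \<omega>) \<partial>M) = of_real (exp (- Re (hermitian_form \<Gamma> b) / 4))"
    and \<Gamma>_nonneg: "0 \<le> Re (hermitian_form \<Gamma> b)" for b
    unfolding assms(11) W\<Phi> using expectation_iexp_analytic_vec[of h, OF h] by blast+
  obtain B where B: "\<And>\<tau>. \<bar>f \<tau>\<bar> \<le> B" using assms(4) by (auto simp: bounded_iff)
  have fh: "integrable lborel (\<lambda>\<tau>. h l \<tau> * of_real (f \<tau>))" for l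
  proof (rule Bochner_Integration.integrable_bound[OF
      integrable_mult_left[OF integrable_norm[OF hi[of l]], of B]])
    have "norm (h l \<tau> * of_real (f \<tau>)) \<le> norm (norm (h l \<tau>) * B)" for \<tau>
      using B[of \<tau>] by (auto simp: norm_mult abs_mult intro!: mult_left_mono)
    then show "AE \<tau> in lborel. norm (h l \<tau> * of_real (f \<tau>)) \<le> norm (norm (h l \<tau>) * B)" by simp
  qed measurable
  have "AE \<omega> in M. \<forall>l\<in>UNIV. integrable lborel (\<lambda>\<tau>. h l \<tau> * of_real (\<Phi> \<tau> \<omega>))"
    using pathwise_integrable[OF hi] by (intro AE_finite_allI) auto
  then have WY: "AE \<omega> in M. W\<^sub>Y \<omega> = W\<^sub>f + W\<^sub>\<Phi> \<omega>"
  proof eventually_elim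
    case (elim \<omega>)
    then show ?case
      using fh by (simp add: assms(8,9,10) W vec_eq_iff distrib_left)
  qed
  have WY_meas[measurable]: "(\<lambda>\<omega>. W\<^sub>Y \<omega> $ l) \<in> borel_measurable M" for l
    unfolding assms(10) W by simp
  have W\<Phi>_meas[measurable]: "(\<lambda>\<omega>. W\<^sub>\<Phi> \<omega> $ l) \<in> borel_measurable M" for l
    unfolding W\<Phi> by simp
  have \<Gamma>: "\<Gamma> $ i $ j = (\<integral>\<omega>. W\<^sub>\<Phi> \<omega> $ i * cnj (W\<^sub>\<Phi> \<omega> $ j) \<partial>M)" for i j
    by (simp add: assms(11) second_moment_matrix_def)
  have \<Gamma>_cnj: "\<Gamma> $ i $ j = cnj (\<Gamma> $ j $ i)" for i j
    unfolding \<Gamma> Bochner_Integration.integral_cnj[symmetric] by (simp add: mult.commute)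
  have \<Gamma>_real: "\<Gamma> $ i $ i = of_real (Re (\<Gamma> $ i $ i))" for i
    using \<Gamma>_cnj[of i i] by (simp add: complex_eq_iff)
  define p g q where "p = Re (\<Gamma> $ 1 $ 1)" and "g = Re (\<Gamma> $ 2 $ 2)" and "q = \<Gamma> $ 1 $ 2"
  interpret H: hermitian_2x2 \<Gamma> p g "p * g - (cmod q)\<^sup>2" q
    by standard (simp_all add: p_def g_def q_def \<Gamma>_real[symmetric] \<Gamma>_cnj[symmetric])
  interpret circular_gaussian_pair M \<Gamma> p g "p * g - (cmod q)\<^sup>2" q W\<^sub>Y W\<^sub>f
  proof (intro circular_gaussian_pair.intro H.pos_def_if_invertible prob_space_axioms)
    show "circular_gaussian_pair_axioms M \<Gamma> W\<^sub>Y W\<^sub>f"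
    proof
      fix b
      have "(\<integral>\<omega>. iexp (b \<bullet> (W\<^sub>Y \<omega> - W\<^sub>f)) \<partial>M) = (\<integral>\<omega>. iexp (b \<bullet> W\<^sub>\<Phi> \<omega>) \<partial>M)"
        by (rule integral_cong_AE)
           (use WY in \<open>auto simp: inner_vec_def elim!: eventually_mono\<close>)
      then show "(\<integral>\<omega>. iexp (b \<bullet> (W\<^sub>Y \<omega> - W\<^sub>f)) \<partial>M) = of_real (exp (- Re (hermitian_form \<Gamma> b) / 4))"
        unfolding char\<Phi> .
    qed (rule WY_meas)
  qed (use \<Gamma>_nonneg assms(12) in auto)
  have dens_nonneg: "0 \<le> normal_product_density \<Gamma> W\<^sub>f w" for w
    using D_pos by (intro normal_product_density_nonneg) (simp add: H.det_eq)
  have comp_nonneg: "0 \<le> complex_normal_density (\<Gamma> $ l $ l) (W\<^sub>f $ l) w" for l w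
    using exhaust_2[of l] p_pos g_pos by (auto simp: complex_normal_density_def p_def g_def)
  have sq: "integrable M (\<lambda>\<omega>. (cmod (W\<^sub>Y \<omega> $ l))\<^sup>2)" for l
  proof (rule Bochner_Integration.integrable_bound)
    show "integrable M (\<lambda>\<omega>. 2 * (cmod (W\<^sub>f $ l))\<^sup>2 + 2 * (cmod (process_integral \<Phi> (h l) \<omega>))\<^sup>2)"
      using integrable_cmod_process_integral_square[OF hi[of l]] by simp
    show "AE \<omega> in M. norm ((cmod (W\<^sub>Y \<omega> $ l))\<^sup>2)
        \<le> norm (2 * (cmod (W\<^sub>f $ l))\<^sup>2 + 2 * (cmod (process_integral \<Phi> (h l) \<omega>))\<^sup>2)"
      using WY
    proof eventually_elim
      case (elim \<omega>)
      have "(cmod (x + y))\<^sup>2 \<le> 2 * (cmod x)\<^sup>2 + 2 * (cmod y)\<^sup>2" for x y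
      proof -
        have "(cmod (x + y))\<^sup>2 \<le> (cmod x + cmod y)\<^sup>2"
          by (intro power_mono norm_triangle_ineq) simp
        also have "\<dots> \<le> 2 * (cmod x)\<^sup>2 + 2 * (cmod y)\<^sup>2"
          using sum_squares_bound[of "cmod x" "cmod y"] by (simp add: power2_sum)
        finally show ?thesis .
      qed
      then show ?case by (simp add: elim W\<Phi>)
    qed
  qed measurable
  have abs_int: "integrable M (\<lambda>\<omega>. cmod (W\<^sub>Y \<omega> $ l))" for l
    by (rule square_integrable_imp_integrable) (auto simp: sq)
  have prod_int: "integrable M (\<lambda>\<omega>. cmod (W\<^sub>Y \<omega> $ 1) * cmod (W\<^sub>Y \<omega> $ 2))"
    by (rule integrable_mult_square) (auto simp: sq)
  have P1: "integrable lborel (\<lambda>w. cmod w * normal_product_density \<Gamma> W\<^sub>f w)"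
    and P2: "(\<integral>w. cmod w * normal_product_density \<Gamma> W\<^sub>f w \<partial>lborel)
        = expectation (\<lambda>\<omega>. cmod (W\<^sub>Y \<omega> $ 1) * cmod (W\<^sub>Y \<omega> $ 2))"
    using distributed_integrable[OF distributed_product, of cmod]
        distributed_integral[OF distributed_product, of cmod]
      prod_int dens_nonneg by (simp_all add: norm_mult mult.commute)
  have C1: "integrable lborel (\<lambda>w. cmod w * complex_normal_density (\<Gamma> $ l $ l) (W\<^sub>f $ l) w)"
    and C2: "(\<integral>w. cmod w * complex_normal_density (\<Gamma> $ l $ l) (W\<^sub>f $ l) w \<partial>lborel)
        = expectation (\<lambda>\<omega>. cmod (W\<^sub>Y \<omega> $ l))" for l
    using distributed_integrable[OF distributed_component[of l], of cmod]
        distributed_integral[OF distributed_component[of l], of cmod]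
      abs_int[of l] comp_nonneg[of l] by (simp_all add: mult.commute)
  show ?thesis
    using distributed_product distributed_component P1 C1
      covariance_eq_expectation_diff[OF abs_int abs_int prod_int]
    by (simp add: P2 C2 UNIV_2)
qed

end
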